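(* Let $d_1,d_2\in\mathbb{N}$ and let $\Phi\in\mathrm{UEB}(d_1,d_2)$ be such that $\Phi(X)=\sum_{i=1}^n\phi_i(X)P_i$ for all $X\in M_{d_1}$, where $\phi_1,\dots,\phi_n:M_{d_1}\to\mathbb{C}$ are distinct pure states and $P_1,\dots,P_n\in M_{d_2}$ are mutually orthogonal projections such that $\sum_{i=1}^nP_i=I_{d_2}$. Given an EB-map $\Psi:M_{d_1}\to M_{d_2}$, the following conditions are equivalent: (i) $\Psi\le_{EB}\Phi$. (ii) $\Psi\le_{CP}\Phi$. (iii) There exist positive contractions $R_1,\dots,R_n\in M_{d_2}$ with $P_iR_j=R_jP_i=\delta_{ij}R_j$ for $1\le i,j\le n$ such that $\Psi(X)=\sum_{i=1}^n\phi_i(X)R_i$ for all $X\in M_{d_1}$. (iv) There exists a positive contraction $R\in\mathrm{range}(\Phi)'\subseteq M_{d_2}$ such that $\Psi(X)=\mathrm{Ad}_{\sqrt R}\circ\Phi(X)=\Phi(X)R$ for all $X\in M_{d_1}$.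
   Context: $M_d$ is the algebra of complex $d\times d$ matrices; $\mathrm{Ad}_V(X)=V^*XV$. A positive contraction is a positive semidefinite matrix $R$ with $R\le I$. $\mathrm{range}(\Phi)'$ is the commutant of the range of $\Phi$ in $M_{d_2}$. A positive semidefinite matrix $X\in M_k\otimes M_{d}$ is separable if $X=\sum_{i=1}^nA_i\otimes B_i$ with $A_i\in M_k$, $B_i\in M_d$ positive semidefinite. A completely positive (CP) map $\Phi:M_{d_1}\to M_{d_2}$ is entanglement breaking (an EB-map) if for every $k\ge1$ and every positive semidefinite $X\in M_k\otimes M_{d_1}$ the matrix $(\mathrm{id}_k\otimes\Phi)(X)$ is separable. $\mathrm{UEB}(d_1,d_2)$ is the set of all unital EB-maps $M_{d_1}\to M_{d_2}$. $\Psi\le_{CP}\Phi$ means that $\Phi-\Psi$ is a CP map (for CP maps $\Phi,\Psi$); $\Psi\le_{EB}\Phi$ means that $\Phi-\Psi$ is an EB-map (for EB-maps $\Phi,\Psi$). A state on $M_d$ is a unital CP map $M_d\to\mathbb{C}$. It is pure if every CP map $\psi$ with $\psi\le_{CP}\phi$ is of the form $\lambda\phi$, $\lambda\ge0$; equivalently $\phi(X)=\langle u,Xu\rangle$ for some unit vector $u\in\mathbb{C}^d$. *)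

theory Defs
  imports "Jordan_Normal_Form.Schur_Decomposition"
begin

text \<open>
  \<open>M\<^sub>d\<close> is \<open>carrier_mat d d\<close> over \<open>complex\<close>.  A map between matrix algebras is a HOL function on
  matrices of which only the values on the carrier matter, so all statements about such
  maps are relativised to carriers.
\<close>

abbreviation mat_sum :: "nat \<Rightarrow> ('i \<Rightarrow> complex mat) \<Rightarrow> 'i set \<Rightarrow> complex mat" where
  "mat_sum d F I \<equiv> finsum (ring_mat TYPE(complex) d ()) F I"

text \<open>The order on \<^typ>\<open>complex\<close> is that of Complex_Order: \<open>0 \<le> z\<close> means that \<open>z\<close> is real and
  nonnegative. Hence a positive semidefinite matrix is automatically Hermitian.\<close>

definition psd :: "nat \<Rightarrow> complex mat \<Rightarrow> bool" where
  "psd d A \<longleftrightarrow> A \<in> carrier_mat d d \<and> (\<forall>v \<in> carrier_vec d. 0 \<le> (A *\<^sub>v v) \<bullet>c v)"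

definition positive_contraction :: "nat \<Rightarrow> complex mat \<Rightarrow> bool" where
  "positive_contraction d R \<longleftrightarrow> psd d R \<and> psd d (1\<^sub>m d - R)"

definition psd_sqrt :: "nat \<Rightarrow> complex mat \<Rightarrow> complex mat" where
  "psd_sqrt d R = (THE S. psd d S \<and> S * S = R)"

definition orth_projection :: "nat \<Rightarrow> complex mat \<Rightarrow> bool" where
  "orth_projection d P \<longleftrightarrow> P \<in> carrier_mat d d \<and> mat_adjoint P = P \<and> P * P = P"

definition Ad :: "complex mat \<Rightarrow> complex mat \<Rightarrow> complex mat" where
  "Ad V X = mat_adjoint V * X * V"

definition commutant :: "nat \<Rightarrow> complex mat set \<Rightarrow> complex mat set" where
  "commutant d S = {T \<in> carrier_mat d d. \<forall>A \<in> S. T * A = A * T}"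

definition map_range :: "nat \<Rightarrow> (complex mat \<Rightarrow> complex mat) \<Rightarrow> complex mat set" where
  "map_range d\<^sub>1 \<Phi> = \<Phi> ` carrier_mat d\<^sub>1 d\<^sub>1"

definition lin_map :: "nat \<Rightarrow> nat \<Rightarrow> (complex mat \<Rightarrow> complex mat) \<Rightarrow> bool" where
  "lin_map d\<^sub>1 d\<^sub>2 \<Phi> \<longleftrightarrow>
     (\<forall>X \<in> carrier_mat d\<^sub>1 d\<^sub>1. \<Phi> X \<in> carrier_mat d\<^sub>2 d\<^sub>2) \<and>
     (\<forall>X \<in> carrier_mat d\<^sub>1 d\<^sub>1. \<forall>Y \<in> carrier_mat d\<^sub>1 d\<^sub>1. \<Phi> (X + Y) = \<Phi> X + \<Phi> Y) \<and>
     (\<forall>c. \<forall>X \<in> carrier_mat d\<^sub>1 d\<^sub>1. \<Phi> (c \<cdot>\<^sub>m X) = c \<cdot>\<^sub>m \<Phi> X)"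

text \<open>\<open>M\<^sub>k \<otimes> M\<^sub>d\<close> is identified with the \<open>kd \<times> kd\<close> matrices, viewed as \<open>k \<times> k\<close> matrices of
  \<open>d \<times> d\<close> blocks: row \<open>i * d + a\<close> is row \<open>a\<close> inside block row \<open>i\<close>.\<close>

definition kron :: "complex mat \<Rightarrow> complex mat \<Rightarrow> complex mat" where
  "kron A B = mat (dim_row A * dim_row B) (dim_col A * dim_col B)
     (\<lambda>(r, c). A $$ (r div dim_row B, c div dim_col B) * B $$ (r mod dim_row B, c mod dim_col B))"

definition mat_block :: "nat \<Rightarrow> complex mat \<Rightarrow> nat \<Rightarrow> nat \<Rightarrow> complex mat" where
  "mat_block d X i j = mat d d (\<lambda>(a, b). X $$ (i * d + a, j * d + b))"

text \<open>\<open>id\<^sub>k \<otimes> \<Phi>\<close> applies \<open>\<Phi>\<close> to each block; lemma \<open>ampliation_kron\<close> gives its values on elementary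
  tensors.\<close>

definition ampliation ::
    "nat \<Rightarrow> nat \<Rightarrow> nat \<Rightarrow> (complex mat \<Rightarrow> complex mat) \<Rightarrow> complex mat \<Rightarrow> complex mat" where
  "ampliation k d\<^sub>1 d\<^sub>2 \<Phi> X = mat (k * d\<^sub>2) (k * d\<^sub>2)
     (\<lambda>(r, c). \<Phi> (mat_block d\<^sub>1 X (r div d\<^sub>2) (c div d\<^sub>2)) $$ (r mod d\<^sub>2, c mod d\<^sub>2))"

lemma ampliation_kron:
  assumes "lin_map d\<^sub>1 d\<^sub>2 \<Phi>" "A \<in> carrier_mat k k" "B \<in> carrier_mat d\<^sub>1 d\<^sub>1"
  shows "ampliation k d\<^sub>1 d\<^sub>2 \<Phi> (kron A B) = kron A (\<Phi> B)"
proof -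
  have \<Phi>B: "\<Phi> B \<in> carrier_mat d\<^sub>2 d\<^sub>2"
    using assms unfolding lin_map_def by blast
  have lt: "i * d\<^sub>1 + a < k * d\<^sub>1" if "i < k" "a < d\<^sub>1" for i a
  proof -
    have "i * d\<^sub>1 + a < Suc i * d\<^sub>1" using that by simp
    also have "\<dots> \<le> k * d\<^sub>1" using that by (intro mult_le_mono1) simp
    finally show ?thesis .
  qed
  have blk: "mat_block d\<^sub>1 (kron A B) i j = A $$ (i, j) \<cdot>\<^sub>m B" if "i < k" "j < k" for i j
    using assms that lt by (intro eq_matI) (auto simp: mat_block_def kron_def)
  have scale: "\<Phi> (A $$ (i, j) \<cdot>\<^sub>m B) = A $$ (i, j) \<cdot>\<^sub>m \<Phi> B" for i j
    using assms unfolding lin_map_def by blast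
  show ?thesis
  proof (rule eq_matI)
    fix r c assume "r < dim_row (kron A (\<Phi> B))" "c < dim_col (kron A (\<Phi> B))"
    then have rc: "r < k * d\<^sub>2" "c < k * d\<^sub>2" using assms \<Phi>B by (auto simp: kron_def)
    then have pos: "0 < d\<^sub>2" by (cases d\<^sub>2) auto
    have "r div d\<^sub>2 < k" "c div d\<^sub>2 < k" using rc by (auto simp: less_mult_imp_div_less)
    then show "ampliation k d\<^sub>1 d\<^sub>2 \<Phi> (kron A B) $$ (r, c) = kron A (\<Phi> B) $$ (r, c)"
      using rc pos assms \<Phi>B
      by (simp only: ampliation_def index_mat(1) prod.case blk scale) (simp add: kron_def)
  qed (use assms \<Phi>B in \<open>auto simp: ampliation_def kron_def\<close>)
qed

definition separable :: "nat \<Rightarrow> nat \<Rightarrow> complex mat \<Rightarrow> bool" where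
  "separable k d X \<longleftrightarrow>
     (\<exists>(n::nat) A B. (\<forall>i \<in> {1..n}. psd k (A i) \<and> psd d (B i)) \<and>
        X = mat_sum (k * d) (\<lambda>i. kron (A i) (B i)) {1..n})"

definition CP_map :: "nat \<Rightarrow> nat \<Rightarrow> (complex mat \<Rightarrow> complex mat) \<Rightarrow> bool" where
  "CP_map d\<^sub>1 d\<^sub>2 \<Phi> \<longleftrightarrow> lin_map d\<^sub>1 d\<^sub>2 \<Phi> \<and>
     (\<forall>k \<ge> 1. \<forall>X. psd (k * d\<^sub>1) X \<longrightarrow> psd (k * d\<^sub>2) (ampliation k d\<^sub>1 d\<^sub>2 \<Phi> X))"

definition EB_map :: "nat \<Rightarrow> nat \<Rightarrow> (complex mat \<Rightarrow> complex mat) \<Rightarrow> bool" where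
  "EB_map d\<^sub>1 d\<^sub>2 \<Phi> \<longleftrightarrow> CP_map d\<^sub>1 d\<^sub>2 \<Phi> \<and>
     (\<forall>k \<ge> 1. \<forall>X. psd (k * d\<^sub>1) X \<longrightarrow> separable k d\<^sub>2 (ampliation k d\<^sub>1 d\<^sub>2 \<Phi> X))"

definition UEB :: "nat \<Rightarrow> nat \<Rightarrow> (complex mat \<Rightarrow> complex mat) set" where
  "UEB d\<^sub>1 d\<^sub>2 = {\<Phi>. EB_map d\<^sub>1 d\<^sub>2 \<Phi> \<and> \<Phi> (1\<^sub>m d\<^sub>1) = 1\<^sub>m d\<^sub>2}"

definition CP_le ::
    "nat \<Rightarrow> nat \<Rightarrow> (complex mat \<Rightarrow> complex mat) \<Rightarrow> (complex mat \<Rightarrow> complex mat) \<Rightarrow> bool" where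
  "CP_le d\<^sub>1 d\<^sub>2 \<Psi> \<Phi> \<longleftrightarrow> CP_map d\<^sub>1 d\<^sub>2 \<Psi> \<and> CP_map d\<^sub>1 d\<^sub>2 \<Phi> \<and> CP_map d\<^sub>1 d\<^sub>2 (\<lambda>X. \<Phi> X - \<Psi> X)"

definition EB_le ::
    "nat \<Rightarrow> nat \<Rightarrow> (complex mat \<Rightarrow> complex mat) \<Rightarrow> (complex mat \<Rightarrow> complex mat) \<Rightarrow> bool" where
  "EB_le d\<^sub>1 d\<^sub>2 \<Psi> \<Phi> \<longleftrightarrow> EB_map d\<^sub>1 d\<^sub>2 \<Psi> \<and> EB_map d\<^sub>1 d\<^sub>2 \<Phi> \<and> EB_map d\<^sub>1 d\<^sub>2 (\<lambda>X. \<Phi> X - \<Psi> X)"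

text \<open>A functional \<open>M\<^sub>d \<rightarrow> \<complex>\<close> is a map into \<open>M\<^sub>1\<close> under the identification of \<open>\<complex>\<close> with \<open>M\<^sub>1\<close>.\<close>

definition to_M1 :: "(complex mat \<Rightarrow> complex) \<Rightarrow> complex mat \<Rightarrow> complex mat" where
  "to_M1 \<phi> X = mat 1 1 (\<lambda>_. \<phi> X)"

definition state :: "nat \<Rightarrow> (complex mat \<Rightarrow> complex) \<Rightarrow> bool" where
  "state d \<phi> \<longleftrightarrow> CP_map d 1 (to_M1 \<phi>) \<and> \<phi> (1\<^sub>m d) = 1"

definition pure_state :: "nat \<Rightarrow> (complex mat \<Rightarrow> complex) \<Rightarrow> bool" where
  "pure_state d \<phi> \<longleftrightarrow> state d \<phi> \<and>
     (\<forall>\<psi>. CP_le d 1 (to_M1 \<psi>) (to_M1 \<phi>) \<longrightarrow>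
        (\<exists>l::real. l \<ge> 0 \<and> (\<forall>X \<in> carrier_mat d d. \<psi> X = of_real l * \<phi> X)))"

end

theory Submission
  imports Defs "Jordan_Normal_Form.Spectral_Radius"
begin

text \<open>
  The heart of the matter is that (ii) implies (iii): an entanglement breaking map is a sum of
  measure-and-prepare terms, and below \<open>\<Phi>\<close> each such term can only see one of the pure states.

  Applying \<open>id \<otimes> \<Psi>\<close> to the unnormalised maximally entangled projection yields a separable matrix,
  which reads \<open>\<Psi>(X) = \<Sum>\<^sub>t f\<^sub>t(X) B\<^sub>t\<close> with positive functionals \<open>f\<^sub>t\<close> and positive semidefinite
  \<open>B\<^sub>t\<close> (\<open>EB_map_holevo_form\<close>).  If \<open>\<Psi> \<le>\<^sub>C\<^sub>P \<Phi>\<close> and \<open>v\<close> lies in the range of \<open>P\<^sub>i\<close>, then for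
  \<open>X \<ge> 0\<close> the inequalities
  \<open>f\<^sub>t(X) \<langle>v, B\<^sub>t v\<rangle> \<le> \<langle>v, \<Psi>(X) v\<rangle> \<le> \<langle>v, \<Phi>(X) v\<rangle> = \<phi>\<^sub>i(X) \<langle>v, v\<rangle>\<close>
  show that \<open>f\<^sub>t\<close> is a multiple of the pure state \<open>\<phi>\<^sub>i\<close> unless \<open>B\<^sub>t v = 0\<close>.  In either case
  \<open>f\<^sub>t(X) B\<^sub>t P\<^sub>i = \<phi>\<^sub>i(X) f\<^sub>t(1) B\<^sub>t P\<^sub>i\<close>, and summing over \<open>t\<close> gives \<open>\<Psi>(X) P\<^sub>i = \<phi>\<^sub>i(X) R P\<^sub>i\<close>
  with \<open>R = \<Psi>(1)\<close>; likewise \<open>P\<^sub>i \<Psi>(X) = \<phi>\<^sub>i(X) P\<^sub>i R\<close> (\<open>EB_below_pure_corner\<close>).  So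
  \<open>\<phi>\<^sub>i(X) P\<^sub>i R P\<^sub>j = P\<^sub>i \<Psi>(X) P\<^sub>j = \<phi>\<^sub>j(X) P\<^sub>i R P\<^sub>j\<close>, and an \<open>X\<close> that separates \<open>\<phi>\<^sub>i\<close> from \<open>\<phi>\<^sub>j\<close>
  kills the off-diagonal corners of \<open>R\<close>.  Hence \<open>R\<close> commutes with every \<open>P\<^sub>i\<close>, and
  \<open>R\<^sub>i = R P\<^sub>i\<close> is the required family.

  The other implications are algebra.  Under (iii), \<open>\<Phi> - \<Psi> = \<Sum>\<^sub>i \<phi>\<^sub>i (P\<^sub>i - R\<^sub>i)\<close> is again
  measure-and-prepare, since \<open>P\<^sub>i - R\<^sub>i = P\<^sub>i (1 - R\<^sub>i) P\<^sub>i \<ge> 0\<close>, so (i) holds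
  (\<open>EB_map_measure_prepare\<close>); and \<open>R = \<Sum>\<^sub>i R\<^sub>i\<close> witnesses (iv).  Under (iv),
  \<open>\<Phi>(X) - \<Psi>(X) = \<Phi>(X) (1 - R)\<close> is \<open>\<Phi>(X)\<close> sandwiched by \<open>\<surd>(1 - R)\<close>, which is (ii)
  (\<open>CP_map_sandwich\<close>).  Both steps that involve (iv) use that the square root of a positive
  semidefinite matrix commutes with whatever the matrix commutes with; this, together with the
  existence and uniqueness of the root, comes from the spectral theorem for Hermitian matrices.
\<close>


section \<open>Adjoints and quadratic forms\<close>

lemma mat_adjoint_dim [simp]:
  "dim_row (mat_adjoint A) = dim_col A" "dim_col (mat_adjoint A) = dim_row A"
  by (auto simp: mat_adjoint_def)

lemma mat_adjoint_carrier [simp, intro]: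
  "A \<in> carrier_mat n m \<Longrightarrow> mat_adjoint A \<in> carrier_mat m n"
  by (rule carrier_matI) auto

lemma mat_adjoint_index:
  assumes "i < dim_col A" "j < dim_row A"
  shows "mat_adjoint A $$ (i, j) = conjugate (A $$ (j, i))"
  using assms by (auto simp: mat_adjoint_def mat_of_rows_index)

lemma mat_adjoint_adjoint [simp]: "mat_adjoint (mat_adjoint A) = A"
  by (rule eq_matI) (auto simp: mat_adjoint_index)

lemma mat_adjoint_mult:
  fixes A B :: "complex mat"
  assumes "A \<in> carrier_mat n m" "B \<in> carrier_mat m l"
  shows "mat_adjoint (A * B) = mat_adjoint B * mat_adjoint A"
  using assms
  by (intro eq_matI) (auto simp: mat_adjoint_index scalar_prod_def mult.commute intro!: sum.cong)

lemma mat_adjoint_minus: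
  fixes A B :: "complex mat"
  assumes "A \<in> carrier_mat n m" "B \<in> carrier_mat n m"
  shows "mat_adjoint (A - B) = mat_adjoint A - mat_adjoint B"
  using assms by (intro eq_matI) (auto simp: mat_adjoint_index)

lemma mat_adjoint_one [simp]: "mat_adjoint (1\<^sub>m n :: complex mat) = 1\<^sub>m n"
  by (intro eq_matI) (auto simp: mat_adjoint_index)

lemma cscalar_prod_adjoint:
  fixes A :: "complex mat"
  assumes "A \<in> carrier_mat n m" "x \<in> carrier_vec m" "y \<in> carrier_vec n"
  shows "(A *\<^sub>v x) \<bullet>c y = x \<bullet>c (mat_adjoint A *\<^sub>v y)"
proof -
  have "(A *\<^sub>v x) \<bullet>c y = (\<Sum>i<n. \<Sum>j<m. A $$ (i, j) * x $ j * cnj (y $ i))"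
    using assms by (auto simp: scalar_prod_def atLeast0LessThan sum_distrib_right)
  also have "\<dots> = (\<Sum>j<m. \<Sum>i<n. A $$ (i, j) * x $ j * cnj (y $ i))"
    by (rule sum.swap)
  also have "\<dots> = x \<bullet>c (mat_adjoint A *\<^sub>v y)"
    using assms
    by (auto simp: scalar_prod_def atLeast0LessThan sum_distrib_left mat_adjoint_index mult_ac
        intro!: sum.cong)
  finally show ?thesis .
qed

lemma zero_mult_mat_vec [simp]: "v \<in> carrier_vec d \<Longrightarrow> 0\<^sub>m n d *\<^sub>v v = 0\<^sub>v n"
  by (intro eq_vecI) auto

lemma cscalar_prod_form:
  fixes A :: "complex mat"
  assumes "A \<in> carrier_mat n m" "x \<in> carrier_vec m" "y \<in> carrier_vec n"
  shows "(A *\<^sub>v x) \<bullet>c y = (\<Sum>i<n. \<Sum>j<m. cnj (y $ i) * A $$ (i, j) * x $ j)"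
  using assms
  by (auto simp: scalar_prod_def atLeast0LessThan sum_distrib_left mult_ac intro!: sum.cong)

section \<open>Positive semidefinite matrices\<close>

lemma psd_carrier: "psd d A \<Longrightarrow> A \<in> carrier_mat d d"
  by (simp add: psd_def)

lemma psd_form_nonneg: "psd d A \<Longrightarrow> v \<in> carrier_vec d \<Longrightarrow> 0 \<le> (A *\<^sub>v v) \<bullet>c v"
  by (simp add: psd_def)

text \<open>
  Coordinates given by functions on indices make reindexing easy; this is the form used for block
  matrices and for entrywise products.
\<close>

lemma psd_iff_sum:
  "psd d A \<longleftrightarrow> A \<in> carrier_mat d d \<and>
     (\<forall>v :: nat \<Rightarrow> complex. 0 \<le> (\<Sum>i<d. \<Sum>j<d. cnj (v i) * A $$ (i, j) * v j))"
proof (cases "A \<in> carrier_mat d d")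
  case True
  have 1: "(A *\<^sub>v vec d v) \<bullet>c vec d v = (\<Sum>i<d. \<Sum>j<d. cnj (v i) * A $$ (i, j) * v j)" for v
    by (subst cscalar_prod_form[OF True]) auto
  have 2: "v = vec d (\<lambda>i. v $ i)" if "v \<in> carrier_vec d" for v :: "complex vec"
    using that by (intro eq_vecI) auto
  have "(\<forall>v \<in> carrier_vec d. 0 \<le> (A *\<^sub>v v) \<bullet>c v) \<longleftrightarrow>
    (\<forall>v :: nat \<Rightarrow> complex. 0 \<le> (A *\<^sub>v vec d v) \<bullet>c vec d v)" (is "?L \<longleftrightarrow> ?R")
  proof
    assume ?R
    show ?L
    proof
      fix v :: "complex vec" assume "v \<in> carrier_vec d"
      then obtain f where "v = vec d f" using 2[of v] by blast
      with \<open>?R\<close> show "0 \<le> (A *\<^sub>v v) \<bullet>c v" by simp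
    qed
  qed auto
  then show ?thesis
    unfolding psd_def 1 using True by blast
qed (auto simp: psd_def)

text \<open>
  A complex matrix whose quadratic form is real is Hermitian, by polarisation: real values at
  \<open>x + y\<close> and at \<open>x + \<i> y\<close> force \<open>\<langle>A y, x\<rangle>\<close> to be the conjugate of \<open>\<langle>A x, y\<rangle>\<close>.
\<close>

lemma psd_adjoint:
  assumes "psd d A"
  shows "mat_adjoint A = A"
proof (rule eq_matI)
  have A: "A \<in> carrier_mat d d" using assms by (rule psd_carrier)
  define B where "B x y = (A *\<^sub>v x) \<bullet>c y" for x y
  have real: "Im (B v v) = 0" if "v \<in> carrier_vec d" for v
    using psd_form_nonneg[OF assms that] by (simp add: B_def less_eq_complex_def)
  fix i j assume "i < dim_row A" "j < dim_col A"
  then have ij: "i < d" "j < d" using A by auto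
  have Bc: "B (unit_vec d a) (unit_vec d b) = A $$ (b, a)" if "a < d" "b < d" for a b
  proof -
    have "conjugate (unit_vec d b) = (unit_vec d b :: complex vec)"
      by (intro eq_vecI) (auto simp: unit_vec_def)
    then show ?thesis
      using A that by (simp add: B_def)
  qed
  have exp: "B (x + c \<cdot>\<^sub>v y) (x + c \<cdot>\<^sub>v y) = B x x + c * cnj c * B y y + cnj c * B x y + c * B y x"
    if xy: "x \<in> carrier_vec d" "y \<in> carrier_vec d" for x y c
  proof -
    have *: "conjugate (x + c \<cdot>\<^sub>v y) = conjugate x + cnj c \<cdot>\<^sub>v conjugate y"
      using xy by (intro eq_vecI) auto
    have "A *\<^sub>v (x + c \<cdot>\<^sub>v y) = A *\<^sub>v x + c \<cdot>\<^sub>v (A *\<^sub>v y)"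
      using A xy by (simp add: mult_add_distrib_mat_vec[OF A] mult_mat_vec[OF A])
    moreover have "(p + c \<cdot>\<^sub>v q) \<bullet> (x' + cnj c \<cdot>\<^sub>v y') =
        p \<bullet> x' + c * cnj c * (q \<bullet> y') + cnj c * (p \<bullet> y') + c * (q \<bullet> x')"
      if "p \<in> carrier_vec d" "q \<in> carrier_vec d" "x' \<in> carrier_vec d" "y' \<in> carrier_vec d"
      for p q x' y' :: "complex vec"
      using that
      by (simp add: add_scalar_prod_distrib[of _ d] scalar_prod_add_distrib[of _ d], simp add: algebra_simps)
    ultimately show ?thesis unfolding B_def *
      using xy mult_mat_vec_carrier[OF A] by simp
  qed
  let ?x = "unit_vec d i :: complex vec" and ?y = "unit_vec d j :: complex vec"
  have "Im (B (?x + c \<cdot>\<^sub>v ?y) (?x + c \<cdot>\<^sub>v ?y)) = 0" for c by (rule real) auto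
  then have "Im (c * cnj c * B ?y ?y + cnj c * B ?x ?y + c * B ?y ?x) = 0" for c
    unfolding exp[OF unit_vec_carrier unit_vec_carrier] using real[of ?x] by (simp add: add_ac)
  from this[of 1] this[of \<i>] have "B ?y ?x = cnj (B ?x ?y)"
    using real[of ?x] real[of ?y] by (simp add: complex_eq_iff)
  then show "mat_adjoint A $$ (i, j) = A $$ (i, j)"
    using ij A by (simp add: Bc mat_adjoint_index)
qed (use assms in \<open>auto dest: psd_carrier\<close>)

lemma psd_sandwich:
  assumes "psd d A" "V \<in> carrier_mat d n"
  shows "psd n (mat_adjoint V * A * V)"
proof -
  have A: "A \<in> carrier_mat d d" using assms(1) by (rule psd_carrier)
  have "((mat_adjoint V * A * V) *\<^sub>v v) \<bullet>c v = (A *\<^sub>v (V *\<^sub>v v)) \<bullet>c (V *\<^sub>v v)"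
    if v: "v \<in> carrier_vec n" for v
  proof -
    have "(mat_adjoint V * A * V) *\<^sub>v v = mat_adjoint V *\<^sub>v (A *\<^sub>v (V *\<^sub>v v))"
      using A assms(2) v
      by (simp add: assoc_mult_mat_vec[of _ n d _ n] assoc_mult_mat_vec[of _ n d _ d]
          mult_carrier_mat[of _ n d])
    then show ?thesis
      using A assms(2) v cscalar_prod_adjoint[of "mat_adjoint V" n d "A *\<^sub>v (V *\<^sub>v v)" v] by simp
  qed
  then show ?thesis
    using A assms by (auto simp: psd_def)
qed

lemma psd_one [simp]: "psd d (1\<^sub>m d)"
  by (auto simp: psd_def)

lemma psd_zero [simp]: "psd d (0\<^sub>m d d)"
  by (auto simp: psd_def)

lemma psd_gram:
  assumes "V \<in> carrier_mat d n"
  shows "psd n (mat_adjoint V * V)"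
  using psd_sandwich[OF psd_one assms] assms by simp

lemma psd_add:
  assumes "psd d A" "psd d B"
  shows "psd d (A + B)"
  using assms by (auto simp: psd_def add_mult_distrib_mat_vec[of _ d d] add_scalar_prod_distrib[of _ d])

lemma orth_projection_psd:
  assumes "orth_projection d P"
  shows "psd d P" and "psd d (1\<^sub>m d - P)"
proof -
  have P: "P \<in> carrier_mat d d" "mat_adjoint P = P" "P * P = P"
    using assms by (auto simp: orth_projection_def)
  show "psd d P" using psd_gram[OF P(1)] P by simp
  have Q: "1\<^sub>m d - P \<in> carrier_mat d d" using P by (simp add: minus_carrier_mat)
  have "(1\<^sub>m d - P) * (1\<^sub>m d - P) = 1\<^sub>m d * (1\<^sub>m d - P) - P * (1\<^sub>m d - P)"
    using P Q by (intro minus_mult_distrib_mat) auto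
  also have "P * (1\<^sub>m d - P) = 0\<^sub>m d d"
    using P by (simp add: mult_minus_distrib_mat[of _ d d _ d])
  also have "1\<^sub>m d * (1\<^sub>m d - P) - 0\<^sub>m d d = 1\<^sub>m d - P"
    unfolding left_mult_one_mat[OF Q] using P by (intro eq_matI) auto
  finally have "(1\<^sub>m d - P) * (1\<^sub>m d - P) = 1\<^sub>m d - P" .
  moreover have "mat_adjoint (1\<^sub>m d - P) = 1\<^sub>m d - P"
    using P mat_adjoint_minus[of "1\<^sub>m d" d d P] by simp
  ultimately show "psd d (1\<^sub>m d - P)" using psd_gram[OF Q] by simp
qed

text \<open>
  The difference equals \<open>P (1 - R) P\<close>.
\<close>

lemma psd_corner_complement:
  assumes R: "positive_contraction d R" and P: "orth_projection d P"
    and PR: "P * R = R" "R * P = R"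
  shows "psd d (P - R)"
proof -
  have c: "P \<in> carrier_mat d d" "R \<in> carrier_mat d d" "mat_adjoint P = P" "P * P = P"
    using R P by (auto simp: orth_projection_def positive_contraction_def dest: psd_carrier)
  have "psd d (mat_adjoint P * (1\<^sub>m d - R) * P)"
    using R c by (intro psd_sandwich) (auto simp: positive_contraction_def)
  moreover have "P * (1\<^sub>m d - R) = P - R"
    using c PR by (simp add: mult_minus_distrib_mat[of _ d d _ d])
  moreover have "(P - R) * P = P - R"
    using c PR by (simp add: minus_mult_distrib_mat[of _ d d _ _ d])
  ultimately show ?thesis using c by simp
qed

text \<open>
  The complement is \<open>1 - R P = (1 - P) + P (1 - R) P\<close>.
\<close>

lemma positive_contraction_compression:
  assumes R: "positive_contraction d R" and P: "orth_projection d P"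
    and comm: "R * P = P * R"
  shows "positive_contraction d (R * P)"
proof -
  have c: "P \<in> carrier_mat d d" "R \<in> carrier_mat d d" "mat_adjoint P = P" "P * P = P"
    using R P by (auto simp: orth_projection_def positive_contraction_def dest: psd_carrier)
  have sandwich: "mat_adjoint P * R * P = R * P"
    using c comm by (metis assoc_mult_mat)
  have "psd d (mat_adjoint P * R * P)"
    using R c by (intro psd_sandwich) (auto simp: positive_contraction_def)
  then have 1: "psd d (R * P)" by (simp only: sandwich)
  have "mat_adjoint P * (1\<^sub>m d - R) * P = (P - P * R) * P"
    using c by (simp add: mult_minus_distrib_mat[of _ d d _ d])
  also have "\<dots> = P * P - P * R * P"
    using c by (intro minus_mult_distrib_mat) auto
  also have "\<dots> = P - R * P" using sandwich c by simp
  finally have "psd d (P - R * P)"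
    using psd_sandwich[of d "1\<^sub>m d - R" P d] R c by (simp add: positive_contraction_def)
  from psd_add[OF orth_projection_psd(2)[OF P] this] have "psd d (1\<^sub>m d - P + (P - R * P))" .
  also have "1\<^sub>m d - P + (P - R * P) = 1\<^sub>m d - R * P"
    using c by (intro eq_matI) auto
  finally show ?thesis using 1 by (simp add: positive_contraction_def)
qed

section \<open>The spectral theorem for Hermitian matrices\<close>

lemma unitary_right_inverse:
  fixes U :: "complex mat"
  assumes "U \<in> carrier_mat d d" "mat_adjoint U * U = 1\<^sub>m d"
  shows "U * mat_adjoint U = 1\<^sub>m d"
  using mat_mult_left_right_inverse[of "mat_adjoint U" d U] assms by auto

text \<open>
  Complete the vector to a basis, orthogonalise it by Gram-Schmidt, and normalise the columns.
\<close>

lemma unitary_with_first_column: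
  fixes v :: "complex vec"
  assumes v: "v \<in> carrier_vec d" and v0: "v \<noteq> 0\<^sub>v d"
  shows "\<exists>U c. U \<in> carrier_mat d d \<and> mat_adjoint U * U = 1\<^sub>m d \<and> col U 0 = c \<cdot>\<^sub>v v"
proof -
  interpret cof_vec_space d "TYPE(complex)" .
  have d: "0 < d" using v v0 by (cases d) auto
  define ws where "ws = gram_schmidt d (basis_completion v)"
  note bc = basis_completion[OF v v0]
  note gs = gram_schmidt_result[OF bc(2) bc(4) bc(5) ws_def]
  have ws: "set ws \<subseteq> carrier_vec d" "corthogonal ws" "length ws = d"
    using gs bc(6) by auto
  obtain vs where "basis_completion v = v # vs"
    using bc(6,7) d by (cases "basis_completion v") auto
  then have hd: "ws ! 0 = v"
    using gram_schmidt_hd[OF v, of vs] ws(3) d unfolding ws_def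
    by (metis hd_conv_nth length_greater_0_conv)
  define r where "r i = complex_of_real (1 / sqrt (Re (ws ! i \<bullet>c ws ! i)))" for i
  define U where "U = mat_of_cols d (map (\<lambda>i. r i \<cdot>\<^sub>v ws ! i) [0..<d])"
  have wsi: "ws ! i \<in> carrier_vec d" if "i < d" for i
    using ws that by (meson nth_mem subsetD)
  have U: "U \<in> carrier_mat d d" by (auto simp: U_def)
  have colU: "col U i = r i \<cdot>\<^sub>v ws ! i" if "i < d" for i
    using that wsi unfolding U_def by (subst col_mat_of_cols) auto
  have "mat_adjoint U * U = 1\<^sub>m d"
  proof (rule eq_matI)
    fix i j assume "i < dim_row (1\<^sub>m d :: complex mat)" "j < dim_col (1\<^sub>m d :: complex mat)"
    then have ij: "i < d" "j < d" by auto
    have "(mat_adjoint U * U) $$ (i, j) = col U j \<bullet>c col U i"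
      using U ij by (auto simp: scalar_prod_def mat_adjoint_index mult.commute intro!: sum.cong)
    also have "\<dots> = r j * cnj (r i) * (ws ! j \<bullet>c ws ! i)"
    proof -
      have "conjugate (r i \<cdot>\<^sub>v ws ! i) = cnj (r i) \<cdot>\<^sub>v conjugate (ws ! i)"
        by (simp add: conjugate_smult_vec)
      then show ?thesis using wsi[OF ij(1)] wsi[OF ij(2)] by (simp add: colU ij)
    qed
    also have "\<dots> = 1\<^sub>m d $$ (i, j)"
    proof (cases "i = j")
      case True
      let ?z = "ws ! i \<bullet>c ws ! i"
      have "?z \<noteq> 0" "0 \<le> ?z"
        using corthogonalD[OF ws(2), of i i] ij ws(3) by auto
      then have "?z = complex_of_real (Re ?z)" "0 < Re ?z"
        by (auto simp: less_eq_complex_def complex_eq_iff)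
      then have "r i * cnj (r i) * ?z = complex_of_real ((1 / sqrt (Re ?z))\<^sup>2 * Re ?z)"
        unfolding r_def by (metis complex_cnj_complex_of_real of_real_mult power2_eq_square)
      also have "(1 / sqrt (Re ?z))\<^sup>2 * Re ?z = 1"
        using \<open>0 < Re ?z\<close> by (simp add: power_divide)
      finally show ?thesis using True ij by simp
    next
      case False
      then show ?thesis using corthogonalD[OF ws(2), of j i] ij ws(3) by auto
    qed
    finally show "(mat_adjoint U * U) $$ (i, j) = 1\<^sub>m d $$ (i, j)" .
  qed (use U in auto)
  then show ?thesis using U colU[OF d] hd by metis
qed

definition real_diag :: "nat \<Rightarrow> (nat \<Rightarrow> real) \<Rightarrow> complex mat" where
  "real_diag d f = mat d d (\<lambda>(i, j). if i = j then complex_of_real (f i) else 0)"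

lemma real_diag_carrier [simp]: "real_diag d f \<in> carrier_mat d d"
  by (simp add: real_diag_def)

lemma hermitian_conjugation:
  fixes A W :: "complex mat"
  assumes "A \<in> carrier_mat d d" "mat_adjoint A = A" "W \<in> carrier_mat d n"
  shows "mat_adjoint (mat_adjoint W * A * W) = mat_adjoint W * A * W"
proof -
  have "mat_adjoint (mat_adjoint W * A * W) = mat_adjoint W * mat_adjoint (mat_adjoint W * A)"
    using assms by (intro mat_adjoint_mult[of _ n d _ n]) auto
  also have "mat_adjoint (mat_adjoint W * A) = A * W"
    using assms by (subst mat_adjoint_mult[of _ n d _ d]) auto
  finally show ?thesis
    using assms by (simp add: assoc_mult_mat[of _ n d _ d _ n])
qed

text \<open>
  Induction on the dimension.  In an orthonormal basis that starts with an eigenvector, a Hermitian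
  matrix splits into a real \<open>1 \<times> 1\<close> block and a smaller Hermitian block.
\<close>

lemma hermitian_spectral:
  fixes A :: "complex mat"
  assumes "A \<in> carrier_mat d d" "mat_adjoint A = A"
  shows "\<exists>U f. U \<in> carrier_mat d d \<and> mat_adjoint U * U = 1\<^sub>m d \<and>
           A = U * real_diag d f * mat_adjoint U"
  using assms
proof (induction d arbitrary: A)
  case 0
  then show ?case by (intro exI[of _ "1\<^sub>m 0"] exI[of _ "\<lambda>_. 0"]) auto
next
  case (Suc d)
  note A = Suc.prems(1)
  obtain e where "e \<in> spectrum A" using spectrum_non_empty[OF A] by auto
  then obtain v where v: "v \<in> carrier_vec (Suc d)" "v \<noteq> 0\<^sub>v (Suc d)" "A *\<^sub>v v = e \<cdot>\<^sub>v v"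
    using A by (auto simp: spectrum_def eigenvalue_def eigenvector_def)
  obtain W c where W: "W \<in> carrier_mat (Suc d) (Suc d)" "mat_adjoint W * W = 1\<^sub>m (Suc d)"
    "col W 0 = c \<cdot>\<^sub>v v" using unitary_with_first_column[OF v(1,2)] by blast
  define A' where "A' = mat_adjoint W * A * W"
  have A': "A' \<in> carrier_mat (Suc d) (Suc d)" using A W by (auto simp: A'_def)
  have adjA': "mat_adjoint A' = A'"
    unfolding A'_def using A W Suc.prems(2) by (intro hermitian_conjugation) auto
  have A'_sym: "A' $$ (i, j) = cnj (A' $$ (j, i))" if "i < Suc d" "j < Suc d" for i j
    using A' that by (subst adjA'[symmetric]) (auto simp: mat_adjoint_index)
  have A'_col: "A' $$ (i, 0) = (if i = 0 then e else 0)" if i: "i < Suc d" for i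
  proof -
    have "A' $$ (i, 0) = row (mat_adjoint W) i \<bullet> (A *\<^sub>v col W 0)"
    proof -
      have "A' = mat_adjoint W * (A * W)"
        unfolding A'_def using A W by (intro assoc_mult_mat) auto
      moreover have "col (A * W) 0 = A *\<^sub>v col W 0"
        using A W(1) by (intro col_mult2) auto
      ultimately show ?thesis using A W(1) i by simp
    qed
    also have "A *\<^sub>v col W 0 = e \<cdot>\<^sub>v col W 0"
      unfolding W(3) using A v by (auto simp: mult_mat_vec smult_smult_assoc mult.commute)
    also have "row (mat_adjoint W) i \<bullet> (e \<cdot>\<^sub>v col W 0) = e * (mat_adjoint W * W) $$ (i, 0)"
      using W(1) i by (simp add: scalar_prod_smult_right)
    finally show ?thesis using i by (simp add: W(2))
  qed
  define A3 where "A3 = mat d d (\<lambda>(i, j). A' $$ (Suc i, Suc j))"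
  have A3: "A3 \<in> carrier_mat d d" by (simp add: A3_def)
  have "mat_adjoint A3 = A3"
    by (intro eq_matI) (auto simp: A3_def mat_adjoint_index A'_sym[symmetric])
  from Suc.IH[OF A3 this] obtain U3 f where U3: "U3 \<in> carrier_mat d d"
    "mat_adjoint U3 * U3 = 1\<^sub>m d" "A3 = U3 * real_diag d f * mat_adjoint U3" by blast
  define g where "g i = (case i of 0 \<Rightarrow> Re e | Suc j \<Rightarrow> f j)" for i
  define U4 where "U4 = four_block_mat (1\<^sub>m 1) (0\<^sub>m 1 d) (0\<^sub>m d 1) U3"
  have U4: "U4 \<in> carrier_mat (Suc d) (Suc d)" using U3 by (auto simp: U4_def)
  have adjU4: "mat_adjoint U4 = four_block_mat (1\<^sub>m 1) (0\<^sub>m 1 d) (0\<^sub>m d 1) (mat_adjoint U3)"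
    using U3(1) by (intro eq_matI) (auto simp: U4_def mat_adjoint_index)
  have e_real: "e = complex_of_real (Re e)"
    using A'_sym[of 0 0, unfolded A'_col[of 0, simplified]] by (simp add: complex_eq_iff)
  have diag: "real_diag (Suc d) g =
      four_block_mat (mat 1 1 (\<lambda>_. e)) (0\<^sub>m 1 d) (0\<^sub>m d 1) (real_diag d f)"
    using e_real by (intro eq_matI) (auto simp: real_diag_def g_def split: nat.splits)
  have A'_row: "A' $$ (0, j) = (if j = 0 then e else 0)" if j: "j < Suc d" for j
  proof -
    have "A' $$ (0, j) = cnj (A' $$ (j, 0))" using j by (intro A'_sym) auto
    then show ?thesis using e_real by (auto simp: A'_col[OF j] complex_eq_iff)
  qed
  have A'_block: "A' = four_block_mat (mat 1 1 (\<lambda>_. e)) (0\<^sub>m 1 d) (0\<^sub>m d 1) A3"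
  proof (rule eq_matI)
    fix i j assume "i < dim_row (four_block_mat (mat 1 1 (\<lambda>_. e)) (0\<^sub>m 1 d) (0\<^sub>m d 1) A3)"
      "j < dim_col (four_block_mat (mat 1 1 (\<lambda>_. e)) (0\<^sub>m 1 d) (0\<^sub>m d 1) A3)"
    then have ij: "i < Suc d" "j < Suc d" by (auto simp: A3_def)
    then show "A' $$ (i, j) = four_block_mat (mat 1 1 (\<lambda>_. e)) (0\<^sub>m 1 d) (0\<^sub>m d 1) A3 $$ (i, j)"
      using A'_col[OF ij(1)] A'_row[OF ij(2)] by (auto simp: A3_def)
  qed (use A' A3 in auto)
  \<comment> \<open>Block diagonal matrices multiply blockwise, so diagonalising the lower block diagonalises the whole.\<close>
  have prod: "four_block_mat (mat 1 1 (\<lambda>_. x)) (0\<^sub>m 1 d) (0\<^sub>m d 1) X *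
      four_block_mat (mat 1 1 (\<lambda>_. y)) (0\<^sub>m 1 d) (0\<^sub>m d 1) Y =
      four_block_mat (mat 1 1 (\<lambda>_. x * y)) (0\<^sub>m 1 d) (0\<^sub>m d 1) (X * Y)"
    if "X \<in> carrier_mat d d" "Y \<in> carrier_mat d d" for x y :: complex and X Y
  proof -
    have "mat 1 1 (\<lambda>_. x) * mat 1 1 (\<lambda>_. y) = mat 1 1 (\<lambda>_. x * y)"
      by (intro eq_matI) (auto simp: scalar_prod_def)
    then show ?thesis
      using that by (subst mult_four_block_mat[of _ 1 1 _ d _ d _ _ 1 _ d]) auto
  qed
  have one: "1\<^sub>m 1 = mat 1 1 (\<lambda>_. 1 :: complex)" by (intro eq_matI) auto
  have U4': "mat_adjoint U4 * U4 = 1\<^sub>m (Suc d)"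
    unfolding adjU4 unfolding U4_def one using U3
    by (subst prod) (auto intro!: eq_matI)
  have A'_eq: "A' = U4 * real_diag (Suc d) g * mat_adjoint U4"
    unfolding A'_block adjU4 diag unfolding U4_def one using U3
    by (simp add: prod del: One_nat_def)
  let ?n = "Suc d"
  let ?U = "W * U4"
  have U: "?U \<in> carrier_mat ?n ?n" using W U4 by auto
  have adjU: "mat_adjoint ?U = mat_adjoint U4 * mat_adjoint W"
    using W U4 by (intro mat_adjoint_mult) auto
  note assoc = assoc_mult_mat[of _ ?n ?n _ ?n _ ?n]
  have WA: "mat_adjoint W \<in> carrier_mat ?n ?n" "mat_adjoint U4 \<in> carrier_mat ?n ?n"
    using W U4 by auto
  note carr = W(1) U4 WA A real_diag_carrier[of ?n g] mult_carrier_mat[of _ ?n ?n _ ?n]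
  have WW: "W * mat_adjoint W = 1\<^sub>m ?n" using W by (intro unitary_right_inverse) auto
  have "mat_adjoint ?U * ?U = mat_adjoint U4 * ((mat_adjoint W * W) * U4)"
    unfolding adjU by (simp add: carr assoc)
  also have "\<dots> = 1\<^sub>m ?n" using W(2) U4 U4' by simp
  finally have 1: "mat_adjoint ?U * ?U = 1\<^sub>m ?n" .
  have "A = (W * mat_adjoint W) * A * (W * mat_adjoint W)"
    using WW A by simp
  also have "\<dots> = W * A' * mat_adjoint W"
    unfolding A'_def by (simp add: carr assoc)
  also have "\<dots> = ?U * real_diag ?n g * mat_adjoint ?U"
    unfolding A'_eq adjU by (simp add: carr assoc)
  finally show ?case using U 1 by blast
qed

section \<open>Square roots\<close>

lemma psd_diag_nonneg:
  assumes "psd d A" "i < d"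
  shows "0 \<le> A $$ (i, i)"
proof -
  have "0 \<le> (\<Sum>a<d. \<Sum>b<d. cnj (if a = i then 1 else 0) * A $$ (a, b) * (if b = i then 1 else 0))"
    using assms(1)[unfolded psd_iff_sum, THEN conjunct2, rule_format, of "\<lambda>a. if a = i then 1 else 0"] .
  also have "\<dots> = (\<Sum>a<d. if a = i then A $$ (a, i) else 0)"
    using assms(2) by (intro sum.cong) (auto simp: if_distrib cong: if_cong)
  also have "\<dots> = A $$ (i, i)" using assms(2) by simp
  finally show ?thesis .
qed

lemma real_diag_index: "i < d \<Longrightarrow> j < d \<Longrightarrow>
    real_diag d f $$ (i, j) = (if i = j then complex_of_real (f i) else 0)"
  by (simp add: real_diag_def)

lemma real_diag_mult_left:
  assumes "X \<in> carrier_mat d d" "i < d" "j < d"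
  shows "(real_diag d f * X) $$ (i, j) = complex_of_real (f i) * X $$ (i, j)"
proof -
  have "(real_diag d f * X) $$ (i, j) = (\<Sum>k<d. real_diag d f $$ (i, k) * X $$ (k, j))"
    using assms real_diag_carrier[of d f]
    by (auto simp: scalar_prod_def atLeast0LessThan simp del: real_diag_carrier)
  also have "\<dots> = (\<Sum>k<d. if k = i then complex_of_real (f i) * X $$ (i, j) else 0)"
    using assms by (intro sum.cong) (auto simp: real_diag_index)
  finally show ?thesis using assms by simp
qed

lemma real_diag_mult_right:
  assumes "X \<in> carrier_mat d d" "i < d" "j < d"
  shows "(X * real_diag d f) $$ (i, j) = X $$ (i, j) * complex_of_real (f j)"
proof -
  have "(X * real_diag d f) $$ (i, j) = (\<Sum>k<d. X $$ (i, k) * real_diag d f $$ (k, j))"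
    using assms real_diag_carrier[of d f]
    by (auto simp: scalar_prod_def atLeast0LessThan simp del: real_diag_carrier)
  also have "\<dots> = (\<Sum>k<d. if k = j then X $$ (i, j) * complex_of_real (f j) else 0)"
    using assms by (intro sum.cong) (auto simp: real_diag_index)
  finally show ?thesis using assms by simp
qed

lemma real_diag_mult: "real_diag d f * real_diag d g = real_diag d (\<lambda>i. f i * g i)"
proof (rule eq_matI)
  fix i j assume "i < dim_row (real_diag d (\<lambda>i. f i * g i))" "j < dim_col (real_diag d (\<lambda>i. f i * g i))"
  then have "i < d" "j < d" by (auto simp: real_diag_def)
  then show "(real_diag d f * real_diag d g) $$ (i, j) = real_diag d (\<lambda>i. f i * g i) $$ (i, j)"
    by (simp add: real_diag_mult_left real_diag_index)
qed (auto simp: real_diag_def)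

lemma psd_real_diag:
  assumes "\<And>i. i < d \<Longrightarrow> 0 \<le> f i"
  shows "psd d (real_diag d f)"
proof -
  have "real_diag d (\<lambda>i. sqrt (f i) * sqrt (f i)) = real_diag d f"
    using assms by (intro eq_matI) (auto simp: real_diag_def)
  moreover have "mat_adjoint (real_diag d (\<lambda>i. sqrt (f i))) = real_diag d (\<lambda>i. sqrt (f i))"
    by (intro eq_matI) (auto simp: mat_adjoint_index real_diag_def)
  ultimately show ?thesis
    using psd_gram[of "real_diag d (\<lambda>i. sqrt (f i))" d d] by (simp add: real_diag_mult)
qed

text \<open>
  Take square roots of the eigenvalues.  In the eigenbasis, commuting with \<open>diag(\<lambda>)\<close> means having zero
  entries wherever \<open>\<lambda>\<^sub>i \<noteq> \<lambda>\<^sub>j\<close>, and \<open>\<surd>\<lambda>\<close> separates the same pairs of indices as \<open>\<lambda>\<close>.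
\<close>

lemma psd_sqrt_exists:
  assumes "psd d A"
  shows "\<exists>S. psd d S \<and> S * S = A \<and> (\<forall>B \<in> carrier_mat d d. A * B = B * A \<longrightarrow> S * B = B * S)"
proof -
  have A: "A \<in> carrier_mat d d" using assms by (rule psd_carrier)
  obtain U f where U: "U \<in> carrier_mat d d" "mat_adjoint U * U = 1\<^sub>m d"
    and A_eq: "A = U * real_diag d f * mat_adjoint U"
    using hermitian_spectral[OF A psd_adjoint[OF assms]] by blast
  let ?V = "mat_adjoint U"
  have V: "?V \<in> carrier_mat d d" using U by auto
  have UV: "U * ?V = 1\<^sub>m d" using U by (rule unitary_right_inverse)
  note assoc = assoc_mult_mat[of _ d d _ d _ d]
  note carr = U(1) V real_diag_carrier[of d] mult_carrier_mat[of _ d d _ d]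
  have cancel: "?V * (U * X) = X" "U * (?V * X) = X" if "X \<in> carrier_mat d d" for X
    using that U V UV by (simp_all add: assoc[symmetric])
  have "?V * A * U = real_diag d f * (?V * U)"
    unfolding A_eq by (simp add: carr assoc cancel)
  then have "?V * A * U = real_diag d f"
    unfolding U(2) by (simp add: right_mult_one_mat[of _ d d])
  then have "psd d (real_diag d f)" using psd_sandwich[OF assms U(1)] by simp
  from psd_diag_nonneg[OF this] have f: "0 \<le> f i" if "i < d" for i
    using that by (simp add: real_diag_index less_eq_complex_def)
  define S where "S = U * real_diag d (\<lambda>i. sqrt (f i)) * ?V"
  have 1: "psd d S"
    using psd_sandwich[OF psd_real_diag[of d "\<lambda>i. sqrt (f i)"] V] f by (simp add: S_def)
  have "S * S = U * (real_diag d (\<lambda>i. sqrt (f i)) * real_diag d (\<lambda>i. sqrt (f i))) * ?V"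
    unfolding S_def by (simp add: carr assoc cancel)
  also have "real_diag d (\<lambda>i. sqrt (f i)) * real_diag d (\<lambda>i. sqrt (f i)) = real_diag d f"
    unfolding real_diag_mult using f by (intro eq_matI) (auto simp: real_diag_def)
  finally have 2: "S * S = A" by (simp add: A_eq)
  have 3: "S * B = B * S" if B: "B \<in> carrier_mat d d" and AB: "A * B = B * A" for B
  proof -
    define C where "C = ?V * B * U"
    have C: "C \<in> carrier_mat d d" using B by (simp add: C_def carr)
    have B_eq: "B = U * C * ?V"
      unfolding C_def using B by (simp add: carr assoc cancel UV)
    have "real_diag d f * C = ?V * (A * B) * U"
      unfolding A_eq C_def using B by (simp add: carr assoc cancel)
    also have "\<dots> = C * real_diag d f * (?V * U)"
      unfolding AB unfolding A_eq C_def using B by (simp add: carr assoc)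
    finally have DC: "real_diag d f * C = C * real_diag d f"
      using U(2) C by (simp add: right_mult_one_mat[of _ d d] carr)
    have "real_diag d (\<lambda>i. sqrt (f i)) * C = C * real_diag d (\<lambda>i. sqrt (f i))"
    proof (rule eq_matI)
      fix i j assume "i < dim_row (C * real_diag d (\<lambda>i. sqrt (f i)))"
        "j < dim_col (C * real_diag d (\<lambda>i. sqrt (f i)))"
      then have ij: "i < d" "j < d" using C by (auto simp: real_diag_def)
      have "complex_of_real (f i) * C $$ (i, j) = C $$ (i, j) * complex_of_real (f j)"
        using real_diag_mult_left[OF C ij, of f] real_diag_mult_right[OF C ij, of f] DC by metis
      then have "C $$ (i, j) = 0 \<or> f i = f j" by auto
      then show "(real_diag d (\<lambda>i. sqrt (f i)) * C) $$ (i, j) = (C * real_diag d (\<lambda>i. sqrt (f i))) $$ (i, j)"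
        using ij C by (auto simp: real_diag_mult_left real_diag_mult_right)
    qed (use C in \<open>auto simp: real_diag_def\<close>)
    then have "U * (real_diag d (\<lambda>i. sqrt (f i)) * C) * ?V = U * (C * real_diag d (\<lambda>i. sqrt (f i))) * ?V"
      by simp
    then show ?thesis
      unfolding S_def B_eq using C by (simp add: carr assoc cancel)
  qed
  show ?thesis using 1 2 3 by blast
qed

text \<open>
  Because \<open>\<langle>A v, v\<rangle> = \<langle>S v, S v\<rangle>\<close> for a square root \<open>S\<close> of \<open>A\<close>.
\<close>

lemma psd_form_eq_0:
  assumes "psd d A" "v \<in> carrier_vec d" "(A *\<^sub>v v) \<bullet>c v = 0"
  shows "A *\<^sub>v v = 0\<^sub>v d"
proof -
  obtain S where S: "psd d S" "S * S = A" using psd_sqrt_exists[OF assms(1)] by blast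
  have Sc: "S \<in> carrier_mat d d" using S(1) by (rule psd_carrier)
  have "(S *\<^sub>v v) \<bullet>c (S *\<^sub>v v) = (A *\<^sub>v v) \<bullet>c v"
    using cscalar_prod_adjoint[OF Sc, of "S *\<^sub>v v" v] Sc assms(2) S psd_adjoint[OF S(1)]
    by (simp flip: S(2))
  then have "S *\<^sub>v v = 0\<^sub>v d" using assms(3) Sc assms(2)
    by (metis conjugate_square_eq_0_vec mult_mat_vec_carrier)
  then show ?thesis using Sc assms(2) by (auto simp flip: S(2))
qed

lemma mat_eq_if_mult_vec_eq:
  fixes A B :: "complex mat"
  assumes "A \<in> carrier_mat n d" "B \<in> carrier_mat n d"
    and "\<And>v. v \<in> carrier_vec d \<Longrightarrow> A *\<^sub>v v = B *\<^sub>v v"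
  shows "A = B"
proof (rule mat_col_eqI)
  fix j assume "j < dim_col B"
  then have j: "j < d" using assms by auto
  have "col X j = X *\<^sub>v unit_vec d j" if "X \<in> carrier_mat n d" for X :: "complex mat"
    using that j by (intro eq_vecI) auto
  then show "col A j = col B j" using assms by simp
qed (use assms in auto)

text \<open>
  Any root \<open>X\<close> commutes with the common square, hence with the root \<open>Q\<close> of \<open>psd_sqrt_exists\<close>, so
  \<open>(X + Q)(X - Q) = 0\<close>.  On the vectors \<open>w = (X - Q) v\<close> the nonnegative forms of \<open>X\<close> and \<open>Q\<close> sum to
  zero, so both vanish and \<open>X w = Q w = 0\<close>; hence \<open>(X - Q)\<^sup>2 = 0\<close>, and \<open>X - Q\<close> is Hermitian.
\<close>

lemma psd_sqrt_unique:
  assumes "psd d S" "psd d T" "S * S = T * T"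
  shows "S = T"
proof -
  obtain Q where Q: "psd d Q" "Q * Q = T * T"
    and comm: "\<And>B. B \<in> carrier_mat d d \<Longrightarrow> T * T * B = B * (T * T) \<Longrightarrow> Q * B = B * Q"
    using psd_sqrt_exists[OF psd_gram[of T d d]] psd_adjoint[OF assms(2)] psd_carrier[OF assms(2)]
    by auto
  have eq_Q: "X = Q" if X: "psd d X" "X * X = T * T" for X
  proof -
    have Xc: "X \<in> carrier_mat d d" and Qc: "Q \<in> carrier_mat d d"
      using X(1) Q(1) by (auto dest: psd_carrier)
    have "T * T * X = X * (T * T)"
      unfolding X(2)[symmetric] using Xc by simp
    then have QX: "Q * X = X * Q" by (rule comm[OF Xc])
    define D where "D = X - Q"
    have D: "D \<in> carrier_mat d d" using Qc by (simp add: D_def minus_carrier_mat)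
    have Dadj: "mat_adjoint D = D"
      unfolding D_def using psd_adjoint[OF X(1)] psd_adjoint[OF Q(1)] mat_adjoint_minus[OF Xc Qc]
      by simp
    have "(X + Q) * D = X * (X - Q) + Q * (X - Q)"
      unfolding D_def using Xc Qc by (intro add_mult_distrib_mat) auto
    also have "\<dots> = (X * X - X * Q) + (Q * X - Q * Q)"
      using Xc Qc by (simp add: mult_minus_distrib_mat[of _ d d _ d])
    also have "\<dots> = 0\<^sub>m d d"
      unfolding QX X(2) Q(2) using Xc Qc psd_carrier[OF assms(2)] by (intro eq_matI) auto
    finally have XQD: "(X + Q) * D = 0\<^sub>m d d" .
    have "D *\<^sub>v v = 0\<^sub>m d d *\<^sub>v v" if v: "v \<in> carrier_vec d" for v
    proof -
      define w where "w = D *\<^sub>v v"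
      have w: "w \<in> carrier_vec d" using D v by (simp add: w_def)
      have "(X + Q) *\<^sub>v w = 0\<^sub>v d"
        unfolding w_def using XQD Xc Qc D v assoc_mult_mat_vec[of "X + Q" d d D d v]
        by auto
      then have "X *\<^sub>v w + Q *\<^sub>v w = 0\<^sub>v d"
        using Xc Qc w by (simp add: add_mult_distrib_mat_vec[of _ d d])
      then have "(X *\<^sub>v w) \<bullet>c w + (Q *\<^sub>v w) \<bullet>c w = 0"
        using Xc Qc w add_scalar_prod_distrib[of "X *\<^sub>v w" d "Q *\<^sub>v w" "conjugate w"] by simp
      then have "(X *\<^sub>v w) \<bullet>c w = 0" "(Q *\<^sub>v w) \<bullet>c w = 0"
        using psd_form_nonneg[OF X(1) w] psd_form_nonneg[OF Q(1) w]
        by (simp_all add: add_nonneg_eq_0_iff)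
      then have "X *\<^sub>v w = 0\<^sub>v d" "Q *\<^sub>v w = 0\<^sub>v d"
        using psd_form_eq_0[OF X(1) w] psd_form_eq_0[OF Q(1) w] by blast+
      then have "D *\<^sub>v w = 0\<^sub>v d"
        unfolding D_def using Xc Qc w by (simp add: minus_mult_distrib_mat_vec[of _ d d])
      then have "w \<bullet>c w = 0"
        using cscalar_prod_adjoint[OF D w v] w v unfolding Dadj w_def[symmetric] by simp
      then have "w = 0\<^sub>v d" using w by simp
      then show ?thesis using v by (simp add: w_def)
    qed
    then have "D = 0\<^sub>m d d" by (intro mat_eq_if_mult_vec_eq[OF D]) auto
    then have "(X - Q) $$ (i, j) = 0" if "i < d" "j < d" for i j
      using that by (simp add: D_def)
    then show "X = Q"
      using Xc Qc by (intro eq_matI) auto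
  qed
  show ?thesis using eq_Q[OF assms(1,3)] eq_Q[OF assms(2)] by simp
qed

lemma psd_sqrt:
  assumes "psd d A"
  shows "psd d (psd_sqrt d A)" "psd_sqrt d A * psd_sqrt d A = A"
    and "\<And>B. B \<in> carrier_mat d d \<Longrightarrow> A * B = B * A \<Longrightarrow> psd_sqrt d A * B = B * psd_sqrt d A"
proof -
  obtain S where S: "psd d S" "S * S = A"
    "\<forall>B \<in> carrier_mat d d. A * B = B * A \<longrightarrow> S * B = B * S"
    using psd_sqrt_exists[OF assms] by blast
  have "psd_sqrt d A = S"
    unfolding psd_sqrt_def using S psd_sqrt_unique by (intro the_equality) auto
  then show "psd d (psd_sqrt d A)" "psd_sqrt d A * psd_sqrt d A = A"
    and "\<And>B. B \<in> carrier_mat d d \<Longrightarrow> A * B = B * A \<Longrightarrow> psd_sqrt d A * B = B * psd_sqrt d A"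
    using S by auto
qed

section \<open>Finite sums of matrices\<close>

lemma mat_sum_carrier [simp]:
  assumes "\<And>i. i \<in> I \<Longrightarrow> F i \<in> carrier_mat d d"
  shows "mat_sum d F I \<in> carrier_mat d d"
proof -
  interpret ring "ring_mat TYPE(complex) d ()" by (rule ring_mat)
  show ?thesis using finsum_closed[of F I] assms by (auto simp: ring_mat_simps)
qed

lemma mat_sum_empty [simp]: "mat_sum d F {} = 0\<^sub>m d d"
proof -
  interpret ring "ring_mat TYPE(complex) d ()" by (rule ring_mat)
  show ?thesis using finsum_empty[of F] by (simp add: ring_mat_simps)
qed

lemma mat_sum_insert [simp]:
  assumes "finite I" "i \<notin> I" "F i \<in> carrier_mat d d" "\<And>j. j \<in> I \<Longrightarrow> F j \<in> carrier_mat d d"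
  shows "mat_sum d F (insert i I) = F i + mat_sum d F I"
proof -
  interpret ring "ring_mat TYPE(complex) d ()" by (rule ring_mat)
  show ?thesis using finsum_insert[of I i F] assms by (auto simp: ring_mat_simps)
qed

lemma mat_sum_index:
  assumes "finite I" "\<And>i. i \<in> I \<Longrightarrow> F i \<in> carrier_mat d d" "a < d" "b < d"
  shows "mat_sum d F I $$ (a, b) = (\<Sum>i\<in>I. F i $$ (a, b))"
  using assms(1,2)
proof (induction I)
  case (insert i I)
  have "mat_sum d F I \<in> carrier_mat d d" using insert.prems by auto
  then show ?case using insert assms(3,4) by (auto simp del: mat_sum_carrier)
qed (use assms in auto)

lemma mat_sum_smult_index:
  assumes "finite I" "\<And>i. i \<in> I \<Longrightarrow> B i \<in> carrier_mat d d" "a < d" "b < d"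
  shows "mat_sum d (\<lambda>i. c i \<cdot>\<^sub>m B i) I $$ (a, b) = (\<Sum>i\<in>I. c i * B i $$ (a, b))"
proof -
  have "mat_sum d (\<lambda>i. c i \<cdot>\<^sub>m B i) I $$ (a, b) = (\<Sum>i\<in>I. (c i \<cdot>\<^sub>m B i) $$ (a, b))"
    using assms by (intro mat_sum_index) auto
  also have "\<dots> = (\<Sum>i\<in>I. c i * B i $$ (a, b))"
  proof (rule sum.cong[OF refl])
    fix i assume "i \<in> I"
    then show "(c i \<cdot>\<^sub>m B i) $$ (a, b) = c i * B i $$ (a, b)"
      using assms(2)[of i] assms(3,4) by auto
  qed
  finally show ?thesis .
qed

lemma mat_sum_mult_left:
  assumes "finite I" "\<And>i. i \<in> I \<Longrightarrow> F i \<in> carrier_mat d d" "A \<in> carrier_mat d d"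
  shows "A * mat_sum d F I = mat_sum d (\<lambda>i. A * F i) I"
  using assms(1,2)
proof (induction I)
  case (insert i I)
  have "mat_sum d F I \<in> carrier_mat d d" using insert.prems by auto
  then show ?case using insert assms(3) by (simp add: mult_add_distrib_mat[of _ d d _ d] mult_carrier_mat[of _ d d])
qed (use assms in auto)

lemma mat_sum_mult_right:
  assumes "finite I" "\<And>i. i \<in> I \<Longrightarrow> F i \<in> carrier_mat d d" "A \<in> carrier_mat d d"
  shows "mat_sum d F I * A = mat_sum d (\<lambda>i. F i * A) I"
  using assms(1,2)
proof (induction I)
  case (insert i I)
  have "mat_sum d F I \<in> carrier_mat d d" using insert.prems by auto
  then show ?case using insert assms(3) by (simp add: add_mult_distrib_mat[of _ d d _ _ d] mult_carrier_mat[of _ d d])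
qed (use assms in auto)

lemma mat_sum_cong:
  assumes "\<And>i. i \<in> I \<Longrightarrow> F i = G i" "\<And>i. i \<in> I \<Longrightarrow> G i \<in> carrier_mat d d"
  shows "mat_sum d F I = mat_sum d G I"
proof -
  interpret ring "ring_mat TYPE(complex) d ()" by (rule ring_mat)
  show ?thesis using assms by (intro finsum_cong') (auto simp: ring_mat_simps)
qed

lemma mat_sum_delta:
  assumes "finite I" "j \<in> I" "M j \<in> carrier_mat d d"
  shows "mat_sum d (\<lambda>i. if i = j then M i else 0\<^sub>m d d) I = M j"
proof (rule eq_matI)
  have S: "mat_sum d (\<lambda>i. if i = j then M i else 0\<^sub>m d d) I \<in> carrier_mat d d"
    using assms by (intro mat_sum_carrier) auto
  show "dim_row (mat_sum d (\<lambda>i. if i = j then M i else 0\<^sub>m d d) I) = dim_row (M j)"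
    "dim_col (mat_sum d (\<lambda>i. if i = j then M i else 0\<^sub>m d d) I) = dim_col (M j)"
    using carrier_matD[OF S] carrier_matD[OF assms(3)] by simp_all
  fix a b assume "a < dim_row (M j)" "b < dim_col (M j)"
  then have ab: "a < d" "b < d" using assms by auto
  have "mat_sum d (\<lambda>i. if i = j then M i else 0\<^sub>m d d) I $$ (a, b) =
      (\<Sum>i\<in>I. (if i = j then M i else 0\<^sub>m d d) $$ (a, b))"
    using assms ab by (intro mat_sum_index) auto
  also have "\<dots> = (\<Sum>i\<in>I. if i = j then M j $$ (a, b) else 0)"
    using ab by (intro sum.cong) auto
  also have "\<dots> = M j $$ (a, b)" using assms by simp
  finally show "mat_sum d (\<lambda>i. if i = j then M i else 0\<^sub>m d d) I $$ (a, b) = M j $$ (a, b)" .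
qed

lemma mat_sum_minus:
  assumes "finite I" "\<And>i. i \<in> I \<Longrightarrow> F i \<in> carrier_mat d d" "\<And>i. i \<in> I \<Longrightarrow> G i \<in> carrier_mat d d"
  shows "mat_sum d F I - mat_sum d G I = mat_sum d (\<lambda>i. F i - G i) I"
proof (rule eq_matI)
  have S: "mat_sum d F I \<in> carrier_mat d d" "mat_sum d G I \<in> carrier_mat d d"
    "mat_sum d (\<lambda>i. F i - G i) I \<in> carrier_mat d d"
    using assms by (auto intro!: mat_sum_carrier minus_carrier_mat)
  show "dim_row (mat_sum d F I - mat_sum d G I) = dim_row (mat_sum d (\<lambda>i. F i - G i) I)"
    "dim_col (mat_sum d F I - mat_sum d G I) = dim_col (mat_sum d (\<lambda>i. F i - G i) I)"
    using carrier_matD[OF S(2)] carrier_matD[OF S(3)] by simp_all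
  fix a b assume "a < dim_row (mat_sum d (\<lambda>i. F i - G i) I)" "b < dim_col (mat_sum d (\<lambda>i. F i - G i) I)"
  then have ab: "a < d" "b < d" using carrier_matD[OF S(3)] by simp_all
  have "(mat_sum d F I - mat_sum d G I) $$ (a, b) = (\<Sum>i\<in>I. F i $$ (a, b)) - (\<Sum>i\<in>I. G i $$ (a, b))"
    using S ab assms by (simp add: mat_sum_index del: mat_sum_carrier)
  also have "\<dots> = (\<Sum>i\<in>I. (F i - G i) $$ (a, b))"
    unfolding sum_subtractf[symmetric]
  proof (rule sum.cong[OF refl])
    fix i assume "i \<in> I"
    then show "F i $$ (a, b) - G i $$ (a, b) = (F i - G i) $$ (a, b)"
      using assms(2,3)[of i] ab by auto
  qed
  also have "\<dots> = mat_sum d (\<lambda>i. F i - G i) I $$ (a, b)"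
    using assms ab by (subst mat_sum_index) (auto intro: minus_carrier_mat)
  finally show "(mat_sum d F I - mat_sum d G I) $$ (a, b) = mat_sum d (\<lambda>i. F i - G i) I $$ (a, b)" .
qed

lemma mat_sum_smult_mult:
  assumes "finite I" "\<And>i. i \<in> I \<Longrightarrow> B i \<in> carrier_mat d d" "M \<in> carrier_mat d d"
  shows "mat_sum d (\<lambda>i. c i \<cdot>\<^sub>m B i) I * M = mat_sum d (\<lambda>i. c i \<cdot>\<^sub>m (B i * M)) I"
    and "M * mat_sum d (\<lambda>i. c i \<cdot>\<^sub>m B i) I = mat_sum d (\<lambda>i. c i \<cdot>\<^sub>m (M * B i)) I"
proof -
  have "mat_sum d (\<lambda>i. c i \<cdot>\<^sub>m B i) I * M = mat_sum d (\<lambda>i. (c i \<cdot>\<^sub>m B i) * M) I"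
    using assms by (intro mat_sum_mult_right) auto
  also have "\<dots> = mat_sum d (\<lambda>i. c i \<cdot>\<^sub>m (B i * M)) I"
    using assms by (intro mat_sum_cong) (auto simp: mult_smult_assoc_mat[of _ d d _ d] mult_smult_distrib[of _ d d _ d] mult_carrier_mat[of _ d d])
  finally show "mat_sum d (\<lambda>i. c i \<cdot>\<^sub>m B i) I * M = mat_sum d (\<lambda>i. c i \<cdot>\<^sub>m (B i * M)) I" .
  have "M * mat_sum d (\<lambda>i. c i \<cdot>\<^sub>m B i) I = mat_sum d (\<lambda>i. M * (c i \<cdot>\<^sub>m B i)) I"
    using assms by (intro mat_sum_mult_left) auto
  also have "\<dots> = mat_sum d (\<lambda>i. c i \<cdot>\<^sub>m (M * B i)) I"
    using assms by (intro mat_sum_cong) (auto simp: mult_smult_assoc_mat[of _ d d _ d] mult_smult_distrib[of _ d d _ d] mult_carrier_mat[of _ d d])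
  finally show "M * mat_sum d (\<lambda>i. c i \<cdot>\<^sub>m B i) I = mat_sum d (\<lambda>i. c i \<cdot>\<^sub>m (M * B i)) I" .
qed

lemma smult_mat_sum:
  assumes "finite I" "\<And>i. i \<in> I \<Longrightarrow> F i \<in> carrier_mat d d"
  shows "c \<cdot>\<^sub>m mat_sum d F I = mat_sum d (\<lambda>i. c \<cdot>\<^sub>m F i) I"
  using assms
proof (induction I)
  case (insert i I)
  have "mat_sum d F I \<in> carrier_mat d d" using insert.prems by auto
  then show ?case using insert by (simp add: add_smult_distrib_left_mat[of _ d d])
qed simp

lemma cscalar_prod_mat_sum:
  assumes "finite I" "\<And>i. i \<in> I \<Longrightarrow> F i \<in> carrier_mat d d" "v \<in> carrier_vec d" "w \<in> carrier_vec d"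
  shows "(mat_sum d F I *\<^sub>v v) \<bullet>c w = (\<Sum>i\<in>I. (F i *\<^sub>v v) \<bullet>c w)"
  using assms(1,2)
proof (induction I)
  case (insert i I)
  have "mat_sum d F I \<in> carrier_mat d d" using insert.prems by auto
  then show ?case using insert assms(3,4)
    by (simp add: add_mult_distrib_mat_vec[of _ d d] add_scalar_prod_distrib[of _ d]
        mult_mat_vec_carrier[of _ d d])
qed (use assms in auto)

lemma psd_mat_sum:
  assumes "finite I" "\<And>i. i \<in> I \<Longrightarrow> psd d (F i)"
  shows "psd d (mat_sum d F I)"
  using assms by (induction I) (auto simp: psd_carrier psd_add)

lemma smult_mult_mat_vec:
  assumes "A \<in> carrier_mat d d" "v \<in> carrier_vec d"
  shows "(c \<cdot>\<^sub>m A) *\<^sub>v v = c \<cdot>\<^sub>v (A *\<^sub>v (v :: complex vec))"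
  using assms by (intro eq_vecI) (auto simp: scalar_prod_def sum_distrib_left mult.assoc)

section \<open>Block matrices, ampliations and Kronecker products\<close>

lemma sum_block_index:
  fixes f :: "nat \<Rightarrow> 'a :: comm_monoid_add"
  shows "(\<Sum>r<k * d. f r) = (\<Sum>i<k. \<Sum>a<d. f (i * d + a))"
proof -
  have "(\<Sum>r<k * d. f r) = (\<Sum>i<k. sum f {i * d..<i * d + d})"
    by (rule sum.nat_group[symmetric])
  also have "\<dots> = (\<Sum>i<k. \<Sum>a<d. f (i * d + a))"
  proof (rule sum.cong[OF refl])
    fix i
    show "sum f {i * d..<i * d + d} = (\<Sum>a<d. f (i * d + a))"
      using sum.shift_bounds_nat_ivl[of f 0 "i * d" d] by (simp add: atLeast0LessThan add.commute)
  qed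
  finally show ?thesis .
qed

lemma block_index_less: "i < k \<Longrightarrow> a < d \<Longrightarrow> i * d + a < k * (d :: nat)"
  using mult_le_mono1[of "Suc i" k d] by simp

lemma mat_block_carrier [simp]: "mat_block d X i j \<in> carrier_mat d d"
  by (simp add: mat_block_def)

text \<open>
  A vector of length \<open>k d\<close> is the same as \<open>k\<close> vectors of length \<open>d\<close>.  Positivity of an ampliation thereby
  becomes a condition on the values of the map on blocks.
\<close>

lemma psd_block_iff:
  "psd (k * d) Y \<longleftrightarrow> Y \<in> carrier_mat (k * d) (k * d) \<and>
     (\<forall>w. (\<forall>i. w i \<in> carrier_vec d) \<longrightarrow>
        0 \<le> (\<Sum>i<k. \<Sum>j<k. (mat_block d Y i j *\<^sub>v w j) \<bullet>c w i))"
proof -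
  have sum_eq: "(\<Sum>i<k. \<Sum>j<k. (mat_block d Y i j *\<^sub>v w j) \<bullet>c w i) =
     (\<Sum>r<k * d. \<Sum>c<k * d. cnj (v r) * Y $$ (r, c) * v c)"
    if w: "\<And>i. w i \<in> carrier_vec d" and wv: "\<And>i a. i < k \<Longrightarrow> a < d \<Longrightarrow> w i $ a = v (i * d + a)" for w v
  proof -
    have "(\<Sum>i<k. \<Sum>j<k. (mat_block d Y i j *\<^sub>v w j) \<bullet>c w i) =
      (\<Sum>i<k. \<Sum>j<k. \<Sum>a<d. \<Sum>b<d. cnj (v (i * d + a)) * Y $$ (i * d + a, j * d + b) * v (j * d + b))"
    proof (intro sum.cong refl)
      fix i j assume ij: "i \<in> {..<k}" "j \<in> {..<k}"
      show "(mat_block d Y i j *\<^sub>v w j) \<bullet>c w i =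
        (\<Sum>a<d. \<Sum>b<d. cnj (v (i * d + a)) * Y $$ (i * d + a, j * d + b) * v (j * d + b))"
        using ij wv by (subst cscalar_prod_form[OF mat_block_carrier w w])
          (auto simp: mat_block_def intro!: sum.cong)
    qed
    also have "\<dots> = (\<Sum>i<k. \<Sum>a<d. \<Sum>j<k. \<Sum>b<d. cnj (v (i * d + a)) * Y $$ (i * d + a, j * d + b) * v (j * d + b))"
      by (intro sum.cong refl sum.swap)
    finally show ?thesis by (simp add: sum_block_index)
  qed
  show ?thesis
  proof (intro iffI conjI allI impI)
    fix w :: "nat \<Rightarrow> complex vec" assume Y: "psd (k * d) Y" and w: "\<forall>i. w i \<in> carrier_vec d"
    show "0 \<le> (\<Sum>i<k. \<Sum>j<k. (mat_block d Y i j *\<^sub>v w j) \<bullet>c w i)"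
    proof -
      have "(\<Sum>i<k. \<Sum>j<k. (mat_block d Y i j *\<^sub>v w j) \<bullet>c w i) = (\<Sum>r<k * d. \<Sum>c<k * d.
          cnj (w (r div d) $ (r mod d)) * Y $$ (r, c) * w (c div d) $ (c mod d))"
        by (rule sum_eq) (use w in auto)
      also have "0 \<le> \<dots>"
        using Y[unfolded psd_iff_sum, THEN conjunct2, rule_format, of "\<lambda>r. w (r div d) $ (r mod d)"] .
      finally show ?thesis .
    qed
  next
    assume *: "Y \<in> carrier_mat (k * d) (k * d) \<and>
     (\<forall>w. (\<forall>i. w i \<in> carrier_vec d) \<longrightarrow>
        0 \<le> (\<Sum>i<k. \<Sum>j<k. (mat_block d Y i j *\<^sub>v w j) \<bullet>c w i))"
    show "psd (k * d) Y" unfolding psd_iff_sum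
    proof (intro conjI allI)
      fix v :: "nat \<Rightarrow> complex"
      have "0 \<le> (\<Sum>i<k. \<Sum>j<k. (mat_block d Y i j *\<^sub>v vec d (\<lambda>a. v (j * d + a))) \<bullet>c vec d (\<lambda>a. v (i * d + a)))"
        using * by simp
      also have "\<dots> = (\<Sum>r<k * d. \<Sum>c<k * d. cnj (v r) * Y $$ (r, c) * v c)"
        by (rule sum_eq) auto
      finally show "0 \<le> (\<Sum>r<k * d. \<Sum>c<k * d. cnj (v r) * Y $$ (r, c) * v c)" .
    qed (use * in auto)
  qed (auto dest: psd_carrier)
qed

lemma ampliation_carrier [simp]: "ampliation k d\<^sub>1 d\<^sub>2 \<Phi> X \<in> carrier_mat (k * d\<^sub>2) (k * d\<^sub>2)"
  by (simp add: ampliation_def)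

lemma mat_block_ampliation:
  assumes "\<Phi> (mat_block d\<^sub>1 X i j) \<in> carrier_mat d\<^sub>2 d\<^sub>2" "i < k" "j < k"
  shows "mat_block d\<^sub>2 (ampliation k d\<^sub>1 d\<^sub>2 \<Phi> X) i j = \<Phi> (mat_block d\<^sub>1 X i j)"
  using assms by (intro eq_matI) (auto simp: mat_block_def ampliation_def block_index_less)

lemma psd_ampliation_iff:
  assumes "\<And>X. X \<in> carrier_mat d\<^sub>1 d\<^sub>1 \<Longrightarrow> \<Phi> X \<in> carrier_mat d\<^sub>2 d\<^sub>2"
  shows "psd (k * d\<^sub>2) (ampliation k d\<^sub>1 d\<^sub>2 \<Phi> X) \<longleftrightarrow>
     (\<forall>w. (\<forall>i. w i \<in> carrier_vec d\<^sub>2) \<longrightarrow>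
        0 \<le> (\<Sum>i<k. \<Sum>j<k. (\<Phi> (mat_block d\<^sub>1 X i j) *\<^sub>v w j) \<bullet>c w i))"
  unfolding psd_block_iff by (simp add: assms mat_block_ampliation)

lemma kron_carrier [simp]:
  "A \<in> carrier_mat k k \<Longrightarrow> B \<in> carrier_mat d d \<Longrightarrow> kron A B \<in> carrier_mat (k * d) (k * d)"
  by (auto simp: kron_def)

lemma mat_block_kron:
  assumes "A \<in> carrier_mat k k" "B \<in> carrier_mat d d" "i < k" "j < k"
  shows "mat_block d (kron A B) i j = A $$ (i, j) \<cdot>\<^sub>m B"
  using assms by (intro eq_matI) (auto simp: mat_block_def kron_def block_index_less)

text \<open>
  With \<open>B = S\<^sup>2\<close> the form of \<open>A \<otimes> B\<close> at \<open>(w\<^sub>i)\<close> is the sum over \<open>a\<close> of the form of \<open>A\<close> at the vectors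
  \<open>((S w\<^sub>i)\<^sub>a)\<^sub>i\<close>.
\<close>

lemma psd_kron:
  assumes A: "psd k A" and B: "psd d B"
  shows "psd (k * d) (kron A B)"
  unfolding psd_block_iff
proof (intro conjI allI impI)
  have Ac: "A \<in> carrier_mat k k" and Bc: "B \<in> carrier_mat d d"
    using A B by (auto dest: psd_carrier)
  then show "kron A B \<in> carrier_mat (k * d) (k * d)" by simp
  fix w :: "nat \<Rightarrow> complex vec" assume "\<forall>i. w i \<in> carrier_vec d"
  then have w: "w i \<in> carrier_vec d" for i by simp
  obtain S where S: "psd d S" "S * S = B" using psd_sqrt[OF B] by blast
  have Sc: "S \<in> carrier_mat d d" using S(1) by (rule psd_carrier)
  have form_B: "(B *\<^sub>v x) \<bullet>c y = (\<Sum>a<d. (S *\<^sub>v x) $ a * cnj ((S *\<^sub>v y) $ a))"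
    if "x \<in> carrier_vec d" "y \<in> carrier_vec d" for x y
  proof -
    have "(B *\<^sub>v x) \<bullet>c y = (S *\<^sub>v x) \<bullet>c (S *\<^sub>v y)"
      using cscalar_prod_adjoint[OF Sc, of "S *\<^sub>v x" y] Sc that psd_adjoint[OF S(1)]
      by (simp flip: S(2))
    also have "\<dots> = (\<Sum>a<d. (S *\<^sub>v x) $ a * conjugate (S *\<^sub>v y) $ a)"
      using Sc that by (simp add: scalar_prod_def[of "S *\<^sub>v x"] atLeast0LessThan)
    finally show ?thesis using Sc that by simp
  qed
  have "(\<Sum>i<k. \<Sum>j<k. (mat_block d (kron A B) i j *\<^sub>v w j) \<bullet>c w i) =
      (\<Sum>i<k. \<Sum>j<k. \<Sum>a<d. cnj ((S *\<^sub>v w i) $ a) * A $$ (i, j) * (S *\<^sub>v w j) $ a)"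
  proof (intro sum.cong refl)
    fix i j assume "i \<in> {..<k}" "j \<in> {..<k}"
    then have "(mat_block d (kron A B) i j *\<^sub>v w j) \<bullet>c w i = A $$ (i, j) * ((B *\<^sub>v w j) \<bullet>c w i)"
      using Ac Bc w by (simp add: mat_block_kron smult_mult_mat_vec mult_mat_vec_carrier[of _ d d]
          smult_scalar_prod_distrib[of _ d])
    then show "(mat_block d (kron A B) i j *\<^sub>v w j) \<bullet>c w i =
      (\<Sum>a<d. cnj ((S *\<^sub>v w i) $ a) * A $$ (i, j) * (S *\<^sub>v w j) $ a)"
      using w by (simp add: form_B sum_distrib_left mult_ac)
  qed
  also have "\<dots> = (\<Sum>i<k. \<Sum>a<d. \<Sum>j<k. cnj ((S *\<^sub>v w i) $ a) * A $$ (i, j) * (S *\<^sub>v w j) $ a)"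
    by (intro sum.cong refl sum.swap)
  also have "\<dots> = (\<Sum>a<d. \<Sum>i<k. \<Sum>j<k. cnj ((S *\<^sub>v w i) $ a) * A $$ (i, j) * (S *\<^sub>v w j) $ a)"
    by (rule sum.swap)
  also have "0 \<le> \<dots>"
  proof (rule sum_nonneg)
    fix a
    show "0 \<le> (\<Sum>i<k. \<Sum>j<k. cnj ((S *\<^sub>v w i) $ a) * A $$ (i, j) * (S *\<^sub>v w j) $ a)"
      using A[unfolded psd_iff_sum, THEN conjunct2, rule_format, of "\<lambda>i. (S *\<^sub>v w i) $ a"] .
  qed
  finally show "0 \<le> (\<Sum>i<k. \<Sum>j<k. (mat_block d (kron A B) i j *\<^sub>v w j) \<bullet>c w i)" .
qed

lemma separable_psd: "separable k d X \<Longrightarrow> psd (k * d) X"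
  unfolding separable_def by (auto intro!: psd_mat_sum psd_kron)

lemma EB_mapI:
  assumes "lin_map d\<^sub>1 d\<^sub>2 \<Phi>"
    and "\<And>k X. k \<ge> 1 \<Longrightarrow> psd (k * d\<^sub>1) X \<Longrightarrow> separable k d\<^sub>2 (ampliation k d\<^sub>1 d\<^sub>2 \<Phi> X)"
  shows "EB_map d\<^sub>1 d\<^sub>2 \<Phi>"
  using assms by (auto simp: EB_map_def CP_map_def intro: separable_psd)

section \<open>Linear maps and positive functionals\<close>

lemma lin_mapD:
  assumes "lin_map d\<^sub>1 d\<^sub>2 \<Phi>"
  shows "X \<in> carrier_mat d\<^sub>1 d\<^sub>1 \<Longrightarrow> \<Phi> X \<in> carrier_mat d\<^sub>2 d\<^sub>2"
    and "X \<in> carrier_mat d\<^sub>1 d\<^sub>1 \<Longrightarrow> Y \<in> carrier_mat d\<^sub>1 d\<^sub>1 \<Longrightarrow> \<Phi> (X + Y) = \<Phi> X + \<Phi> Y"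
    and "X \<in> carrier_mat d\<^sub>1 d\<^sub>1 \<Longrightarrow> \<Phi> (c \<cdot>\<^sub>m X) = c \<cdot>\<^sub>m \<Phi> X"
  using assms by (auto simp: lin_map_def)

lemma lin_map_zero:
  assumes "lin_map d\<^sub>1 d\<^sub>2 \<Phi>"
  shows "\<Phi> (0\<^sub>m d\<^sub>1 d\<^sub>1) = 0\<^sub>m d\<^sub>2 d\<^sub>2"
proof -
  have "\<Phi> (0 \<cdot>\<^sub>m 0\<^sub>m d\<^sub>1 d\<^sub>1) = 0 \<cdot>\<^sub>m \<Phi> (0\<^sub>m d\<^sub>1 d\<^sub>1)"
    by (rule lin_mapD[OF assms]) simp
  also have "\<dots> = 0\<^sub>m d\<^sub>2 d\<^sub>2"
    using lin_mapD(1)[OF assms, of "0\<^sub>m d\<^sub>1 d\<^sub>1"] by (intro eq_matI) auto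
  also have "0 \<cdot>\<^sub>m 0\<^sub>m d\<^sub>1 d\<^sub>1 = (0\<^sub>m d\<^sub>1 d\<^sub>1 :: complex mat)"
    by (intro eq_matI) auto
  finally show ?thesis .
qed

lemma lin_map_mat_sum:
  assumes \<Phi>: "lin_map d\<^sub>1 d\<^sub>2 \<Phi>" and "finite I" "\<And>i. i \<in> I \<Longrightarrow> F i \<in> carrier_mat d\<^sub>1 d\<^sub>1"
  shows "\<Phi> (mat_sum d\<^sub>1 F I) = mat_sum d\<^sub>2 (\<lambda>i. \<Phi> (F i)) I"
  using assms(2,3)
proof (induction I)
  case (insert i I)
  then show ?case by (simp add: lin_mapD[OF \<Phi>])
qed (simp add: lin_map_zero[OF \<Phi>])

lemma lin_map_minus:
  assumes \<Phi>: "lin_map d\<^sub>1 d\<^sub>2 \<Phi>" and \<Psi>: "lin_map d\<^sub>1 d\<^sub>2 \<Psi>"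
  shows "lin_map d\<^sub>1 d\<^sub>2 (\<lambda>X. \<Phi> X - \<Psi> X)"
  unfolding lin_map_def
proof (intro conjI ballI allI)
  fix X Y :: "complex mat" and c :: complex
  assume X: "X \<in> carrier_mat d\<^sub>1 d\<^sub>1"
  note carr = lin_mapD(1)[OF \<Phi>] lin_mapD(1)[OF \<Psi>]
  show "\<Phi> X - \<Psi> X \<in> carrier_mat d\<^sub>2 d\<^sub>2" using carr[OF X] by (simp add: minus_carrier_mat)
  show "\<Phi> (c \<cdot>\<^sub>m X) - \<Psi> (c \<cdot>\<^sub>m X) = c \<cdot>\<^sub>m (\<Phi> X - \<Psi> X)"
    unfolding lin_mapD(3)[OF \<Phi> X] lin_mapD(3)[OF \<Psi> X]
    using carr[OF X] by (intro eq_matI) (auto simp: right_diff_distrib)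
  assume Y: "Y \<in> carrier_mat d\<^sub>1 d\<^sub>1"
  show "\<Phi> (X + Y) - \<Psi> (X + Y) = \<Phi> X - \<Psi> X + (\<Phi> Y - \<Psi> Y)"
    unfolding lin_mapD(2)[OF \<Phi> X Y] lin_mapD(2)[OF \<Psi> X Y]
    using carr[OF X] carr[OF Y] by (intro eq_matI) auto
qed

lemma lin_map_to_M1_iff:
  "lin_map d 1 (to_M1 f) \<longleftrightarrow>
     (\<forall>X \<in> carrier_mat d d. \<forall>Y \<in> carrier_mat d d. f (X + Y) = f X + f Y) \<and>
     (\<forall>c. \<forall>X \<in> carrier_mat d d. f (c \<cdot>\<^sub>m X) = c * f X)"
proof -
  have eq: "A = B \<longleftrightarrow> A $$ (0, 0) = B $$ (0, 0)"
    if "A \<in> carrier_mat 1 1" "B \<in> carrier_mat 1 1" for A B :: "complex mat"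
    using that by (auto intro!: eq_matI)
  have c: "to_M1 f X \<in> carrier_mat 1 1" for X by (simp add: to_M1_def)
  have "to_M1 f (X + Y) = to_M1 f X + to_M1 f Y \<longleftrightarrow> f (X + Y) = f X + f Y" for X Y
    by (subst eq) (auto simp: to_M1_def)
  moreover have "to_M1 f (a \<cdot>\<^sub>m X) = a \<cdot>\<^sub>m to_M1 f X \<longleftrightarrow> f (a \<cdot>\<^sub>m X) = a * f X" for X a
    by (subst eq) (auto simp: to_M1_def)
  ultimately show ?thesis unfolding lin_map_def using c by simp
qed

lemma functional_mat_sum:
  assumes f: "lin_map d 1 (to_M1 f)" and "finite I" "\<And>i. i \<in> I \<Longrightarrow> F i \<in> carrier_mat d d"
  shows "f (mat_sum d F I) = (\<Sum>i\<in>I. f (F i))"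
proof -
  have "f (mat_sum d F I) = to_M1 f (mat_sum d F I) $$ (0, 0)" by (simp add: to_M1_def)
  also have "to_M1 f (mat_sum d F I) = mat_sum 1 (\<lambda>i. to_M1 f (F i)) I"
    by (rule lin_map_mat_sum[OF assms])
  also have "\<dots> $$ (0, 0) = (\<Sum>i\<in>I. to_M1 f (F i) $$ (0, 0))"
    using assms(2) by (intro mat_sum_index) (auto simp: to_M1_def)
  finally show ?thesis by (simp add: to_M1_def)
qed

text \<open>
  For functionals positivity already implies complete positivity:
  \<open>\<Sum>\<^sub>i\<^sub>j f(X\<^sub>i\<^sub>j) c\<^sub>j c\<^sub>i\<^sup>*\<close> is the value of \<open>f\<close> at the compression \<open>M = \<Sum>\<^sub>i\<^sub>j c\<^sub>j c\<^sub>i\<^sup>* X\<^sub>i\<^sub>j\<close>, which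
  is positive semidefinite.
\<close>

lemma positive_functional_CP:
  assumes f: "lin_map d 1 (to_M1 f)" and pos: "\<And>X. psd d X \<Longrightarrow> 0 \<le> f X"
  shows "CP_map d 1 (to_M1 f)"
  unfolding CP_map_def
proof (intro conjI allI impI)
  fix k :: nat and X assume X: "psd (k * d) X"
  have f_smult: "f (c \<cdot>\<^sub>m Y) = c * f Y" if "Y \<in> carrier_mat d d" for c Y
    using f that by (simp add: lin_map_to_M1_iff del: One_nat_def)
  have "0 \<le> (\<Sum>i<k. \<Sum>j<k. (to_M1 f (mat_block d X i j) *\<^sub>v w j) \<bullet>c w i)"
    if w: "\<forall>i. w i \<in> carrier_vec 1" for w
  proof -
    define c where "c i = w i $ 0" for i
    define M where "M = mat_sum d (\<lambda>(i, j). (c j * cnj (c i)) \<cdot>\<^sub>m mat_block d X i j) ({..<k} \<times> {..<k})"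
    have M: "M \<in> carrier_mat d d" unfolding M_def by (rule mat_sum_carrier) auto
    have "psd d M"
      unfolding psd_def
    proof (intro conjI ballI M)
      fix v :: "complex vec" assume v: "v \<in> carrier_vec d"
      have "(M *\<^sub>v v) \<bullet>c v =
        (\<Sum>(i, j)\<in>{..<k} \<times> {..<k}. (((c j * cnj (c i)) \<cdot>\<^sub>m mat_block d X i j) *\<^sub>v v) \<bullet>c v)"
        unfolding M_def using v by (subst cscalar_prod_mat_sum) (auto simp: case_prod_unfold)
      also have "\<dots> = (\<Sum>(i, j)\<in>{..<k} \<times> {..<k}. (mat_block d X i j *\<^sub>v (c j \<cdot>\<^sub>v v)) \<bullet>c (c i \<cdot>\<^sub>v v))"
        using v mult_mat_vec_carrier[OF mat_block_carrier v]
        by (intro sum.cong)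
          (auto simp: smult_mult_mat_vec[of _ d] mult_mat_vec[of _ d d] conjugate_smult_vec
            smult_scalar_prod_distrib[of _ d] scalar_prod_smult_distrib[of _ d])
      also have "\<dots> = (\<Sum>i<k. \<Sum>j<k. (mat_block d X i j *\<^sub>v (c j \<cdot>\<^sub>v v)) \<bullet>c (c i \<cdot>\<^sub>v v))"
        by (simp add: sum.cartesian_product)
      also have "0 \<le> \<dots>"
        using X[unfolded psd_block_iff, THEN conjunct2, rule_format, of "\<lambda>i. c i \<cdot>\<^sub>v v"] v by simp
      finally show "0 \<le> (M *\<^sub>v v) \<bullet>c v" .
    qed
    then have "0 \<le> f M" by (rule pos)
    also have "f M = (\<Sum>(i, j)\<in>{..<k} \<times> {..<k}. (c j * cnj (c i)) * f (mat_block d X i j))"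
      unfolding M_def by (subst functional_mat_sum[OF f]) (auto simp: f_smult intro!: sum.cong)
    also have "\<dots> = (\<Sum>i<k. \<Sum>j<k. (c j * cnj (c i)) * f (mat_block d X i j))"
      by (simp add: sum.cartesian_product)
    also have "\<dots> = (\<Sum>i<k. \<Sum>j<k. (to_M1 f (mat_block d X i j) *\<^sub>v w j) \<bullet>c w i)"
    proof (intro sum.cong refl)
      fix i j
      have "dim_vec (w i) = 1" "dim_vec (w j) = 1" using w by auto
      then show "c j * cnj (c i) * f (mat_block d X i j) =
          (to_M1 f (mat_block d X i j) *\<^sub>v w j) \<bullet>c w i"
        by (simp add: to_M1_def c_def scalar_prod_def)
    qed
    finally show ?thesis .
  qed
  then show "psd (k * 1) (ampliation k d 1 (to_M1 f) X)"
    by (subst psd_ampliation_iff) (auto simp: to_M1_def)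
qed (use f in simp)

text \<open>
  The case \<open>k = 1\<close> of complete positivity.
\<close>

lemma CP_map_psd:
  assumes "CP_map d\<^sub>1 d\<^sub>2 \<Phi>" "psd d\<^sub>1 X"
  shows "psd d\<^sub>2 (\<Phi> X)"
proof -
  have X: "X \<in> carrier_mat d\<^sub>1 d\<^sub>1" using assms(2) by (rule psd_carrier)
  have \<Phi>X: "\<Phi> X \<in> carrier_mat d\<^sub>2 d\<^sub>2"
    using assms(1) X unfolding CP_map_def by (auto intro: lin_mapD)
  have "mat_block d\<^sub>1 X 0 0 = X" using X by (intro eq_matI) (auto simp: mat_block_def)
  then have "ampliation 1 d\<^sub>1 d\<^sub>2 \<Phi> X = \<Phi> X"
    using \<Phi>X by (intro eq_matI) (auto simp: ampliation_def)
  moreover have "psd (1 * d\<^sub>2) (ampliation 1 d\<^sub>1 d\<^sub>2 \<Phi> X)"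
    using assms unfolding CP_map_def by (metis mult_1 order_refl)
  ultimately show ?thesis by simp
qed

lemma CP_map_sandwich:
  assumes \<Phi>: "CP_map d\<^sub>1 d\<^sub>2 \<Phi>" and V: "V \<in> carrier_mat d\<^sub>2 d\<^sub>3"
    and lin: "lin_map d\<^sub>1 d\<^sub>3 \<Theta>"
    and \<Theta>: "\<And>X. X \<in> carrier_mat d\<^sub>1 d\<^sub>1 \<Longrightarrow> \<Theta> X = mat_adjoint V * \<Phi> X * V"
  shows "CP_map d\<^sub>1 d\<^sub>3 \<Theta>"
  unfolding CP_map_def
proof (intro conjI allI impI lin)
  fix k :: nat and X assume k: "1 \<le> k" and X: "psd (k * d\<^sub>1) X"
  have \<Phi>c: "\<Phi> Y \<in> carrier_mat d\<^sub>2 d\<^sub>2" if "Y \<in> carrier_mat d\<^sub>1 d\<^sub>1" for Y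
    using \<Phi> that unfolding CP_map_def by (auto intro: lin_mapD)
  have \<Phi>X: "psd (k * d\<^sub>2) (ampliation k d\<^sub>1 d\<^sub>2 \<Phi> X)" using \<Phi> k X unfolding CP_map_def by blast
  have "0 \<le> (\<Sum>i<k. \<Sum>j<k. (\<Theta> (mat_block d\<^sub>1 X i j) *\<^sub>v w j) \<bullet>c w i)"
    if w: "\<forall>i. w i \<in> carrier_vec d\<^sub>3" for w
  proof -
    have wc: "w i \<in> carrier_vec d\<^sub>3" "V *\<^sub>v w i \<in> carrier_vec d\<^sub>2" for i
      using w V by (auto intro: mult_mat_vec_carrier)
    have "(\<Theta> (mat_block d\<^sub>1 X i j) *\<^sub>v w j) \<bullet>c w i =
        (\<Phi> (mat_block d\<^sub>1 X i j) *\<^sub>v (V *\<^sub>v w j)) \<bullet>c (V *\<^sub>v w i)" for i j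
    proof -
      let ?M = "\<Phi> (mat_block d\<^sub>1 X i j)"
      have M: "?M \<in> carrier_mat d\<^sub>2 d\<^sub>2" by (rule \<Phi>c) simp
      have "(mat_adjoint V * ?M * V) *\<^sub>v w j = mat_adjoint V *\<^sub>v (?M *\<^sub>v (V *\<^sub>v w j))"
        using M V wc
        by (simp add: assoc_mult_mat_vec[of _ d\<^sub>3 d\<^sub>2 _ d\<^sub>3] assoc_mult_mat_vec[of _ d\<^sub>3 d\<^sub>2 _ d\<^sub>2]
            mult_carrier_mat[of _ d\<^sub>3 d\<^sub>2])
      then show ?thesis
        using \<Theta>[of "mat_block d\<^sub>1 X i j"] M V wc
          cscalar_prod_adjoint[of "mat_adjoint V" d\<^sub>3 d\<^sub>2 "?M *\<^sub>v (V *\<^sub>v w j)" "w i"]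
        by (simp add: mult_mat_vec_carrier[of _ d\<^sub>2 d\<^sub>2])
    qed
    moreover have "\<forall>w. (\<forall>i. w i \<in> carrier_vec d\<^sub>2) \<longrightarrow>
        0 \<le> (\<Sum>i<k. \<Sum>j<k. (\<Phi> (mat_block d\<^sub>1 X i j) *\<^sub>v w j) \<bullet>c w i)"
      using \<Phi>X psd_ampliation_iff[of d\<^sub>1 \<Phi> d\<^sub>2 k X, OF \<Phi>c] by blast
    ultimately show ?thesis using wc by simp
  qed
  then show "psd (k * d\<^sub>3) (ampliation k d\<^sub>1 d\<^sub>3 \<Theta> X)"
    by (subst psd_ampliation_iff) (auto intro: lin_mapD[OF lin])
qed

lemma CP_functional_nonneg:
  assumes "CP_map d 1 (to_M1 f)" "psd d X"
  shows "0 \<le> f X"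
  using psd_diag_nonneg[OF CP_map_psd[OF assms], of 0] by (simp add: to_M1_def)

section \<open>Entanglement breaking maps in measure-and-prepare form\<close>

text \<open>
  This makes \<open>X \<mapsto> \<Sum>\<^sub>i\<^sub>j X\<^sub>i\<^sub>j A\<^sub>i\<^sub>j\<close> a positive functional for \<open>A \<ge> 0\<close>.
\<close>

lemma psd_schur_pairing:
  assumes A: "psd k A" and B: "psd k B"
  shows "0 \<le> (\<Sum>i<k. \<Sum>j<k. A $$ (i, j) * B $$ (i, j))"
proof -
  obtain S where S: "psd k S" "S * S = A" using psd_sqrt[OF A] by blast
  have Sc: "S \<in> carrier_mat k k" using S(1) by (rule psd_carrier)
  have "(\<Sum>i<k. \<Sum>j<k. A $$ (i, j) * B $$ (i, j)) =
      (\<Sum>i<k. \<Sum>j<k. \<Sum>l<k. cnj (S $$ (l, i)) * B $$ (i, j) * S $$ (l, j))"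
  proof (intro sum.cong refl)
    fix i j assume ij: "i \<in> {..<k}" "j \<in> {..<k}"
    have "A $$ (i, j) = (\<Sum>l<k. mat_adjoint S $$ (i, l) * S $$ (l, j))"
      using ij Sc by (simp add: psd_adjoint[OF S(1)] scalar_prod_def atLeast0LessThan flip: S(2))
    also have "\<dots> = (\<Sum>l<k. cnj (S $$ (l, i)) * S $$ (l, j))"
      using ij Sc by (intro sum.cong) (auto simp: mat_adjoint_index)
    finally show "A $$ (i, j) * B $$ (i, j) =
        (\<Sum>l<k. cnj (S $$ (l, i)) * B $$ (i, j) * S $$ (l, j))"
      by (simp add: sum_distrib_left mult_ac)
  qed
  also have "\<dots> = (\<Sum>i<k. \<Sum>l<k. \<Sum>j<k. cnj (S $$ (l, i)) * B $$ (i, j) * S $$ (l, j))"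
    by (intro sum.cong refl sum.swap)
  also have "\<dots> = (\<Sum>l<k. \<Sum>i<k. \<Sum>j<k. cnj (S $$ (l, i)) * B $$ (i, j) * S $$ (l, j))"
    by (rule sum.swap)
  also have "0 \<le> \<dots>"
  proof (rule sum_nonneg)
    fix l
    show "0 \<le> (\<Sum>i<k. \<Sum>j<k. cnj (S $$ (l, i)) * B $$ (i, j) * S $$ (l, j))"
      using B[unfolded psd_iff_sum, THEN conjunct2, rule_format, of "\<lambda>i. S $$ (l, i)"] .
  qed
  finally show ?thesis .
qed

text \<open>
  The blocks of the maximally entangled matrix \<open>\<Omega>\<close> are the matrix units \<open>E\<^sub>i\<^sub>j\<close>.  Reading a separable
  decomposition \<open>\<Sum>\<^sub>t A\<^sub>t \<otimes> B\<^sub>t\<close> of \<open>(id \<otimes> \<Psi>)(\<Omega>)\<close> block by block gives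
  \<open>\<Psi>(E\<^sub>i\<^sub>j) = \<Sum>\<^sub>t (A\<^sub>t)\<^sub>i\<^sub>j B\<^sub>t\<close>, and linearity does the rest, with \<open>f\<^sub>t(X) = \<Sum>\<^sub>i\<^sub>j X\<^sub>i\<^sub>j (A\<^sub>t)\<^sub>i\<^sub>j\<close>.
\<close>

lemma EB_map_holevo_form:
  assumes EB: "EB_map d\<^sub>1 d\<^sub>2 \<Psi>" and d: "d\<^sub>1 \<ge> 1"
  shows "\<exists>(m::nat) f B. (\<forall>t \<in> {1..m}. CP_map d\<^sub>1 1 (to_M1 (f t)) \<and> psd d\<^sub>2 (B t)) \<and>
           (\<forall>X \<in> carrier_mat d\<^sub>1 d\<^sub>1. \<Psi> X = mat_sum d\<^sub>2 (\<lambda>t. f t X \<cdot>\<^sub>m B t) {1..m})"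
proof -
  have lin: "lin_map d\<^sub>1 d\<^sub>2 \<Psi>" using EB by (auto simp: EB_map_def CP_map_def)
  \<comment> \<open>The row vector \<open>\<Sum>\<^sub>i e\<^sub>i \<otimes> e\<^sub>i\<close>: index \<open>c\<close> stands for the pair \<open>(c div d\<^sub>1, c mod d\<^sub>1)\<close>.\<close>
  define V :: "complex mat" where "V = mat 1 (d\<^sub>1 * d\<^sub>1) (\<lambda>(_, c). if c div d\<^sub>1 = c mod d\<^sub>1 then 1 else 0)"
  define \<Omega> where "\<Omega> = mat_adjoint V * V"
  define E :: "nat \<Rightarrow> nat \<Rightarrow> complex mat"
    where "E i j = mat d\<^sub>1 d\<^sub>1 (\<lambda>(a, b). if a = i \<and> b = j then 1 else 0)" for i j
  have V: "V \<in> carrier_mat 1 (d\<^sub>1 * d\<^sub>1)" by (simp add: V_def)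
  have E: "E i j \<in> carrier_mat d\<^sub>1 d\<^sub>1" for i j by (simp add: E_def)
  have "psd (d\<^sub>1 * d\<^sub>1) \<Omega>" unfolding \<Omega>_def by (rule psd_gram[OF V])
  then have "separable d\<^sub>1 d\<^sub>2 (ampliation d\<^sub>1 d\<^sub>1 d\<^sub>2 \<Psi> \<Omega>)"
    using EB d unfolding EB_map_def by blast
  then obtain m :: nat and A B where AB: "\<And>t. t \<in> {1..m} \<Longrightarrow> psd d\<^sub>1 (A t) \<and> psd d\<^sub>2 (B t)"
    and amp: "ampliation d\<^sub>1 d\<^sub>1 d\<^sub>2 \<Psi> \<Omega> = mat_sum (d\<^sub>1 * d\<^sub>2) (\<lambda>t. kron (A t) (B t)) {1..m}"
    unfolding separable_def by blast
  have Ac: "A t \<in> carrier_mat d\<^sub>1 d\<^sub>1" and Bc: "B t \<in> carrier_mat d\<^sub>2 d\<^sub>2" if "t \<in> {1..m}" for t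
    using AB[OF that] by (auto dest: psd_carrier)
  have \<Omega>_block: "mat_block d\<^sub>1 \<Omega> i j = E i j" if "i < d\<^sub>1" "j < d\<^sub>1" for i j
    using that V
    by (intro eq_matI)
      (auto simp: mat_block_def E_def \<Omega>_def V_def scalar_prod_def mat_adjoint_index block_index_less)
  have \<Psi>E: "\<Psi> (E i j) = mat_sum d\<^sub>2 (\<lambda>t. A t $$ (i, j) \<cdot>\<^sub>m B t) {1..m}" if ij: "i < d\<^sub>1" "j < d\<^sub>1" for i j
  proof (rule eq_matI)
    have S: "mat_sum d\<^sub>2 (\<lambda>t. A t $$ (i, j) \<cdot>\<^sub>m B t) {1..m} \<in> carrier_mat d\<^sub>2 d\<^sub>2"
      using Bc by (intro mat_sum_carrier) auto
    fix a b assume "a < dim_row (mat_sum d\<^sub>2 (\<lambda>t. A t $$ (i, j) \<cdot>\<^sub>m B t) {1..m})"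
      "b < dim_col (mat_sum d\<^sub>2 (\<lambda>t. A t $$ (i, j) \<cdot>\<^sub>m B t) {1..m})"
    then have ab: "a < d\<^sub>2" "b < d\<^sub>2" using S by auto
    have "\<Psi> (E i j) = mat_block d\<^sub>2 (ampliation d\<^sub>1 d\<^sub>1 d\<^sub>2 \<Psi> \<Omega>) i j"
      using ij E lin_mapD(1)[OF lin] by (subst mat_block_ampliation) (auto simp: \<Omega>_block)
    then have "\<Psi> (E i j) $$ (a, b) =
        mat_sum (d\<^sub>1 * d\<^sub>2) (\<lambda>t. kron (A t) (B t)) {1..m} $$ (i * d\<^sub>2 + a, j * d\<^sub>2 + b)"
      using ab by (simp add: amp mat_block_def)
    also have "\<dots> = (\<Sum>t\<in>{1..m}. kron (A t) (B t) $$ (i * d\<^sub>2 + a, j * d\<^sub>2 + b))"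
      using Ac Bc ij ab by (intro mat_sum_index) (auto simp: block_index_less)
    also have "\<dots> = (\<Sum>t\<in>{1..m}. A t $$ (i, j) * B t $$ (a, b))"
    proof (rule sum.cong[OF refl])
      fix t assume t: "t \<in> {1..m}"
      have "kron (A t) (B t) $$ (i * d\<^sub>2 + a, j * d\<^sub>2 + b) = mat_block d\<^sub>2 (kron (A t) (B t)) i j $$ (a, b)"
        using ab by (simp add: mat_block_def)
      then show "kron (A t) (B t) $$ (i * d\<^sub>2 + a, j * d\<^sub>2 + b) = A t $$ (i, j) * B t $$ (a, b)"
        using Ac[OF t] Bc[OF t] ij ab by (simp add: mat_block_kron)
    qed
    also have "\<dots> = mat_sum d\<^sub>2 (\<lambda>t. A t $$ (i, j) \<cdot>\<^sub>m B t) {1..m} $$ (a, b)"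
      using Bc ab by (subst mat_sum_smult_index) auto
    finally show "\<Psi> (E i j) $$ (a, b) = mat_sum d\<^sub>2 (\<lambda>t. A t $$ (i, j) \<cdot>\<^sub>m B t) {1..m} $$ (a, b)" .
  next
    have "mat_sum d\<^sub>2 (\<lambda>t. A t $$ (i, j) \<cdot>\<^sub>m B t) {1..m} \<in> carrier_mat d\<^sub>2 d\<^sub>2"
      using Bc by (intro mat_sum_carrier) auto
    moreover have "\<Psi> (E i j) \<in> carrier_mat d\<^sub>2 d\<^sub>2" using lin_mapD(1)[OF lin E] .
    ultimately show "dim_row (\<Psi> (E i j)) = dim_row (mat_sum d\<^sub>2 (\<lambda>t. A t $$ (i, j) \<cdot>\<^sub>m B t) {1..m})"
      "dim_col (\<Psi> (E i j)) = dim_col (mat_sum d\<^sub>2 (\<lambda>t. A t $$ (i, j) \<cdot>\<^sub>m B t) {1..m})"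
      by simp_all
  qed
  define f where "f t X = (\<Sum>i<d\<^sub>1. \<Sum>j<d\<^sub>1. X $$ (i, j) * A t $$ (i, j))" for t X
  have "lin_map d\<^sub>1 1 (to_M1 (f t))" for t
    unfolding lin_map_to_M1_iff f_def
  proof (intro conjI ballI allI)
    fix X Y :: "complex mat" and c :: complex
    assume X: "X \<in> carrier_mat d\<^sub>1 d\<^sub>1"
    show "(\<Sum>i<d\<^sub>1. \<Sum>j<d\<^sub>1. (c \<cdot>\<^sub>m X) $$ (i, j) * A t $$ (i, j)) =
        c * (\<Sum>i<d\<^sub>1. \<Sum>j<d\<^sub>1. X $$ (i, j) * A t $$ (i, j))"
      using X by (simp add: sum_distrib_left mult.assoc)
    assume Y: "Y \<in> carrier_mat d\<^sub>1 d\<^sub>1"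
    show "(\<Sum>i<d\<^sub>1. \<Sum>j<d\<^sub>1. (X + Y) $$ (i, j) * A t $$ (i, j)) =
        (\<Sum>i<d\<^sub>1. \<Sum>j<d\<^sub>1. X $$ (i, j) * A t $$ (i, j)) +
        (\<Sum>i<d\<^sub>1. \<Sum>j<d\<^sub>1. Y $$ (i, j) * A t $$ (i, j))"
      using X Y by (simp add: distrib_right sum.distrib)
  qed
  moreover have "0 \<le> f t X" if "t \<in> {1..m}" "psd d\<^sub>1 X" for t X
    unfolding f_def using that AB by (intro psd_schur_pairing) auto
  ultimately have fCP: "CP_map d\<^sub>1 1 (to_M1 (f t))" if "t \<in> {1..m}" for t
    using that by (intro positive_functional_CP) auto
  have "\<Psi> X = mat_sum d\<^sub>2 (\<lambda>t. f t X \<cdot>\<^sub>m B t) {1..m}" if X: "X \<in> carrier_mat d\<^sub>1 d\<^sub>1" for X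
  proof -
    let ?I = "{..<d\<^sub>1} \<times> {..<d\<^sub>1}"
    let ?F = "\<lambda>(i, j). X $$ (i, j) \<cdot>\<^sub>m E i j"
    have F: "?F p \<in> carrier_mat d\<^sub>1 d\<^sub>1" for p using E by (cases p) auto
    have "X = mat_sum d\<^sub>1 ?F ?I"
    proof (rule eq_matI)
      have S: "mat_sum d\<^sub>1 ?F ?I \<in> carrier_mat d\<^sub>1 d\<^sub>1" using F by (intro mat_sum_carrier) auto
      then show "dim_row X = dim_row (mat_sum d\<^sub>1 ?F ?I)" "dim_col X = dim_col (mat_sum d\<^sub>1 ?F ?I)"
        using X by auto
      fix a b assume "a < dim_row (mat_sum d\<^sub>1 ?F ?I)" "b < dim_col (mat_sum d\<^sub>1 ?F ?I)"
      then have ab: "a < d\<^sub>1" "b < d\<^sub>1" using S by auto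
      have "mat_sum d\<^sub>1 ?F ?I $$ (a, b) = (\<Sum>p\<in>?I. ?F p $$ (a, b))"
        using ab F by (intro mat_sum_index) auto
      also have "\<dots> = (\<Sum>p\<in>?I. if p = (a, b) then X $$ (a, b) else 0)"
        using ab by (intro sum.cong) (auto simp: E_def split: if_splits)
      also have "\<dots> = X $$ (a, b)" using ab by simp
      finally show "X $$ (a, b) = mat_sum d\<^sub>1 ?F ?I $$ (a, b)" by simp
    qed
    then have "\<Psi> X = \<Psi> (mat_sum d\<^sub>1 ?F ?I)" by simp
    also have "\<dots> = mat_sum d\<^sub>2 (\<lambda>p. \<Psi> (?F p)) ?I"
      using F by (intro lin_map_mat_sum[OF lin]) auto
    finally have \<Psi>X: "\<Psi> X = mat_sum d\<^sub>2 (\<lambda>p. \<Psi> (?F p)) ?I" .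
    show ?thesis
    proof (rule eq_matI)
      have S: "mat_sum d\<^sub>2 (\<lambda>t. f t X \<cdot>\<^sub>m B t) {1..m} \<in> carrier_mat d\<^sub>2 d\<^sub>2"
        using Bc by (intro mat_sum_carrier) auto
      have \<Psi>c: "\<Psi> X \<in> carrier_mat d\<^sub>2 d\<^sub>2" using lin_mapD(1)[OF lin X] .
      show "dim_row (\<Psi> X) = dim_row (mat_sum d\<^sub>2 (\<lambda>t. f t X \<cdot>\<^sub>m B t) {1..m})"
        "dim_col (\<Psi> X) = dim_col (mat_sum d\<^sub>2 (\<lambda>t. f t X \<cdot>\<^sub>m B t) {1..m})"
        using S \<Psi>c by simp_all
      fix a b assume "a < dim_row (mat_sum d\<^sub>2 (\<lambda>t. f t X \<cdot>\<^sub>m B t) {1..m})"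
        "b < dim_col (mat_sum d\<^sub>2 (\<lambda>t. f t X \<cdot>\<^sub>m B t) {1..m})"
      then have ab: "a < d\<^sub>2" "b < d\<^sub>2" using S by auto
      have "\<Psi> X $$ (a, b) = (\<Sum>p\<in>?I. \<Psi> (?F p) $$ (a, b))"
        unfolding \<Psi>X using ab F lin_mapD(1)[OF lin] by (intro mat_sum_index) auto
      also have "\<dots> = (\<Sum>(i, j)\<in>?I. \<Sum>t\<in>{1..m}. X $$ (i, j) * A t $$ (i, j) * B t $$ (a, b))"
      proof (rule sum.cong[OF refl])
        fix p assume "p \<in> ?I"
        then obtain i j where p: "p = (i, j)" "i < d\<^sub>1" "j < d\<^sub>1" by auto
        have "\<Psi> (?F p) = X $$ (i, j) \<cdot>\<^sub>m mat_sum d\<^sub>2 (\<lambda>t. A t $$ (i, j) \<cdot>\<^sub>m B t) {1..m}"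
          using p E by (simp add: lin_mapD(3)[OF lin] \<Psi>E)
        moreover have "mat_sum d\<^sub>2 (\<lambda>t. A t $$ (i, j) \<cdot>\<^sub>m B t) {1..m} \<in> carrier_mat d\<^sub>2 d\<^sub>2"
          using Bc by (intro mat_sum_carrier) auto
        moreover have "mat_sum d\<^sub>2 (\<lambda>t. A t $$ (i, j) \<cdot>\<^sub>m B t) {1..m} $$ (a, b) =
            (\<Sum>t\<in>{1..m}. A t $$ (i, j) * B t $$ (a, b))"
          using Bc ab by (subst mat_sum_smult_index) auto
        ultimately show "\<Psi> (?F p) $$ (a, b) =
            (case p of (i, j) \<Rightarrow> \<Sum>t\<in>{1..m}. X $$ (i, j) * A t $$ (i, j) * B t $$ (a, b))"
          using ab by (simp add: p(1) sum_distrib_left mult.assoc)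
      qed
      also have "\<dots> = (\<Sum>t\<in>{1..m}. \<Sum>(i, j)\<in>?I. X $$ (i, j) * A t $$ (i, j) * B t $$ (a, b))"
        unfolding case_prod_unfold by (rule sum.swap)
      also have "\<dots> = (\<Sum>t\<in>{1..m}. f t X * B t $$ (a, b))"
        unfolding f_def by (simp add: sum_distrib_right sum.cartesian_product)
      also have "\<dots> = mat_sum d\<^sub>2 (\<lambda>t. f t X \<cdot>\<^sub>m B t) {1..m} $$ (a, b)"
        using Bc ab by (subst mat_sum_smult_index) auto
      finally show "\<Psi> X $$ (a, b) = mat_sum d\<^sub>2 (\<lambda>t. f t X \<cdot>\<^sub>m B t) {1..m} $$ (a, b)" .
    qed
  qed
  then show ?thesis using fCP AB by blast
qed

text \<open>
  The converse of the previous form: an ampliation of \<open>\<Sum>\<^sub>i f\<^sub>i Q\<^sub>i\<close> is separable as it stands, the left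
  factors being the ampliations of the functionals.
\<close>

lemma EB_map_measure_prepare:
  fixes n :: nat
  assumes lin: "lin_map d\<^sub>1 d\<^sub>2 \<Theta>"
    and f: "\<And>i. i \<in> {1..n} \<Longrightarrow> CP_map d\<^sub>1 1 (to_M1 (f i))"
    and Q: "\<And>i. i \<in> {1..n} \<Longrightarrow> psd d\<^sub>2 (Q i)"
    and \<Theta>: "\<And>X. X \<in> carrier_mat d\<^sub>1 d\<^sub>1 \<Longrightarrow> \<Theta> X = mat_sum d\<^sub>2 (\<lambda>i. f i X \<cdot>\<^sub>m Q i) {1..n}"
  shows "EB_map d\<^sub>1 d\<^sub>2 \<Theta>"
proof (rule EB_mapI[OF lin])
  fix k :: nat and X assume k: "k \<ge> 1" and X: "psd (k * d\<^sub>1) X"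
  define A where "A i = ampliation k d\<^sub>1 1 (to_M1 (f i)) X" for i
  have A: "psd k (A i)" if "i \<in> {1..n}" for i
    using f[OF that] k X unfolding CP_map_def A_def by (metis mult.right_neutral)
  have Qc: "Q i \<in> carrier_mat d\<^sub>2 d\<^sub>2" if "i \<in> {1..n}" for i
    using Q[OF that] by (rule psd_carrier)
  have kc: "kron (A i) (Q i) \<in> carrier_mat (k * d\<^sub>2) (k * d\<^sub>2)" if "i \<in> {1..n}" for i
    using psd_carrier[OF A[OF that]] Qc[OF that] by simp
  have "ampliation k d\<^sub>1 d\<^sub>2 \<Theta> X = mat_sum (k * d\<^sub>2) (\<lambda>i. kron (A i) (Q i)) {1..n}"
  proof (rule eq_matI)
    have S: "mat_sum (k * d\<^sub>2) (\<lambda>i. kron (A i) (Q i)) {1..n} \<in> carrier_mat (k * d\<^sub>2) (k * d\<^sub>2)"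
      using kc by (rule mat_sum_carrier)
    then show "dim_row (ampliation k d\<^sub>1 d\<^sub>2 \<Theta> X) = dim_row (mat_sum (k * d\<^sub>2) (\<lambda>i. kron (A i) (Q i)) {1..n})"
      "dim_col (ampliation k d\<^sub>1 d\<^sub>2 \<Theta> X) = dim_col (mat_sum (k * d\<^sub>2) (\<lambda>i. kron (A i) (Q i)) {1..n})"
      by (simp_all add: ampliation_def)
    fix r c assume "r < dim_row (mat_sum (k * d\<^sub>2) (\<lambda>i. kron (A i) (Q i)) {1..n})"
      "c < dim_col (mat_sum (k * d\<^sub>2) (\<lambda>i. kron (A i) (Q i)) {1..n})"
    then have rc: "r < k * d\<^sub>2" "c < k * d\<^sub>2" using S by auto
    have mods: "r mod d\<^sub>2 < d\<^sub>2" "c mod d\<^sub>2 < d\<^sub>2" using rc by (cases "d\<^sub>2 = 0"; simp)+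
    have divs: "r div d\<^sub>2 < k" "c div d\<^sub>2 < k" using rc by (auto simp: less_mult_imp_div_less)
    let ?Y = "mat_block d\<^sub>1 X (r div d\<^sub>2) (c div d\<^sub>2)"
    have "ampliation k d\<^sub>1 d\<^sub>2 \<Theta> X $$ (r, c) = \<Theta> ?Y $$ (r mod d\<^sub>2, c mod d\<^sub>2)"
      using rc by (simp add: ampliation_def)
    also have "\<dots> = (\<Sum>i\<in>{1..n}. f i ?Y * Q i $$ (r mod d\<^sub>2, c mod d\<^sub>2))"
      using Qc mods by (subst \<Theta>, simp, subst mat_sum_smult_index) auto
    also have "\<dots> = (\<Sum>i\<in>{1..n}. kron (A i) (Q i) $$ (r, c))"
    proof (rule sum.cong[OF refl])
      fix i assume i: "i \<in> {1..n}"
      show "f i ?Y * Q i $$ (r mod d\<^sub>2, c mod d\<^sub>2) = kron (A i) (Q i) $$ (r, c)"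
        using rc divs Qc[OF i] psd_carrier[OF A[OF i]]
        by (simp add: kron_def) (simp add: A_def ampliation_def to_M1_def)
    qed
    also have "\<dots> = mat_sum (k * d\<^sub>2) (\<lambda>i. kron (A i) (Q i)) {1..n} $$ (r, c)"
      using kc rc by (subst mat_sum_index) auto
    finally show "ampliation k d\<^sub>1 d\<^sub>2 \<Theta> X $$ (r, c) =
        mat_sum (k * d\<^sub>2) (\<lambda>i. kron (A i) (Q i)) {1..n} $$ (r, c)" .
  qed
  then show "separable k d\<^sub>2 (ampliation k d\<^sub>1 d\<^sub>2 \<Theta> X)"
    unfolding separable_def using A Q by blast
qed

section \<open>Maps dominated by orthogonal corners of pure states\<close>

lemma complex_pos_real:
  assumes "0 \<le> (z :: complex)" "z \<noteq> 0"
  shows "\<exists>r. z = complex_of_real r \<and> r > 0"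
  using assms by (intro exI[of _ "Re z"]) (auto simp: less_eq_complex_def complex_eq_iff)

text \<open>
  Purity in the form needed below: a positive functional that is dominated by \<open>\<phi>\<close> up to a positive
  factor is a multiple of \<open>\<phi>\<close>, and evaluating at \<open>1\<close> identifies the multiple.
\<close>

lemma pure_state_dominated:
  assumes pure: "pure_state d \<phi>" and f: "CP_map d 1 (to_M1 f)" and c: "c > 0"
    and le: "\<And>X. psd d X \<Longrightarrow> complex_of_real c * f X \<le> \<phi> X"
    and X: "X \<in> carrier_mat d d"
  shows "f X = f (1\<^sub>m d) * \<phi> X"
proof -
  have \<phi>: "CP_map d 1 (to_M1 \<phi>)" "\<phi> (1\<^sub>m d) = 1"
    using pure by (auto simp: pure_state_def state_def)
  note lins = f[unfolded CP_map_def, THEN conjunct1, unfolded lin_map_to_M1_iff]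
    \<phi>(1)[unfolded CP_map_def, THEN conjunct1, unfolded lin_map_to_M1_iff]
  \<comment> \<open>Purity speaks of functionals below \<open>\<phi>\<close> itself, so it is applied to \<open>c f\<close>.\<close>
  define \<psi> where "\<psi> Y = complex_of_real c * f Y" for Y
  have \<psi>CP: "CP_map d 1 (to_M1 \<psi>)"
  proof (rule positive_functional_CP)
    show "lin_map d 1 (to_M1 \<psi>)"
      unfolding lin_map_to_M1_iff \<psi>_def using lins by (simp add: algebra_simps)
    show "0 \<le> \<psi> Y" if "psd d Y" for Y
      unfolding \<psi>_def using c CP_functional_nonneg[OF f that]
      by (intro mult_nonneg_nonneg) (auto simp: less_eq_complex_def)
  qed
  have "CP_map d 1 (to_M1 (\<lambda>Y. \<phi> Y - \<psi> Y))"
  proof (rule positive_functional_CP)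
    show "lin_map d 1 (to_M1 (\<lambda>Y. \<phi> Y - \<psi> Y))"
      unfolding lin_map_to_M1_iff \<psi>_def using lins by (simp add: algebra_simps)
    show "0 \<le> \<phi> Y - \<psi> Y" if "psd d Y" for Y
      unfolding \<psi>_def using le[OF that] by simp
  qed
  moreover have "to_M1 (\<lambda>Y. \<phi> Y - \<psi> Y) = (\<lambda>Y. to_M1 \<phi> Y - to_M1 \<psi> Y)"
    by (rule ext, intro eq_matI) (auto simp: to_M1_def)
  ultimately have "CP_le d 1 (to_M1 \<psi>) (to_M1 \<phi>)"
    using \<psi>CP \<phi>(1) by (simp add: CP_le_def)
  then obtain l :: real where l: "\<And>Y. Y \<in> carrier_mat d d \<Longrightarrow> \<psi> Y = of_real l * \<phi> Y"
    using pure unfolding pure_state_def by blast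
  have "complex_of_real c * f X = of_real l * \<phi> X" "complex_of_real c * f (1\<^sub>m d) = of_real l"
    using l[OF X] l[of "1\<^sub>m d"] \<phi>(2) by (auto simp: \<psi>_def)
  then have "complex_of_real c * f X = complex_of_real c * (f (1\<^sub>m d) * \<phi> X)" by simp
  then show ?thesis using c by simp
qed

text \<open>
  Each measure-and-prepare term \<open>f\<^sub>t B\<^sub>t\<close> of \<open>\<Psi>\<close> either vanishes on the range of \<open>P\<close> or has \<open>f\<^sub>t\<close>
  proportional to \<open>\<phi>\<close>.  Entanglement breaking is essential: for vector states
  \<open>\<phi>\<^sub>i(X) = \<langle>u\<^sub>i, X u\<^sub>i\<rangle>\<close>, a completely positive map below \<open>\<Sum>\<^sub>i \<phi>\<^sub>i P\<^sub>i\<close> may have a corner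
  \<open>X \<mapsto> \<langle>u\<^sub>i, X u\<^sub>j\<rangle> T\<close> between two different projections.
\<close>

lemma EB_below_pure_corner:
  assumes d: "d\<^sub>1 \<ge> 1" and EB: "EB_map d\<^sub>1 d\<^sub>2 \<Psi>" and le: "CP_le d\<^sub>1 d\<^sub>2 \<Psi> \<Phi>"
    and pure: "pure_state d\<^sub>1 \<phi>" and P: "orth_projection d\<^sub>2 P"
    and \<Phi>P: "\<And>X. X \<in> carrier_mat d\<^sub>1 d\<^sub>1 \<Longrightarrow> \<Phi> X * P = \<phi> X \<cdot>\<^sub>m P"
    and X: "X \<in> carrier_mat d\<^sub>1 d\<^sub>1"
  shows "\<Psi> X * P = \<phi> X \<cdot>\<^sub>m (\<Psi> (1\<^sub>m d\<^sub>1) * P)" and "P * \<Psi> X = \<phi> X \<cdot>\<^sub>m (P * \<Psi> (1\<^sub>m d\<^sub>1))"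
proof -
  obtain m :: nat and f B where
    fB: "\<And>t. t \<in> {1..m} \<Longrightarrow> CP_map d\<^sub>1 1 (to_M1 (f t)) \<and> psd d\<^sub>2 (B t)"
    and \<Psi>: "\<And>X. X \<in> carrier_mat d\<^sub>1 d\<^sub>1 \<Longrightarrow> \<Psi> X = mat_sum d\<^sub>2 (\<lambda>t. f t X \<cdot>\<^sub>m B t) {1..m}"
    using EB_map_holevo_form[OF EB d] by blast
  have Pc: "P \<in> carrier_mat d\<^sub>2 d\<^sub>2" and Padj: "mat_adjoint P = P"
    using P by (auto simp: orth_projection_def)
  have Bc: "B t \<in> carrier_mat d\<^sub>2 d\<^sub>2" if "t \<in> {1..m}" for t
    using fB[OF that] by (auto dest: psd_carrier)
  have \<Phi>c: "\<Phi> Y \<in> carrier_mat d\<^sub>2 d\<^sub>2" and \<Psi>c: "\<Psi> Y \<in> carrier_mat d\<^sub>2 d\<^sub>2"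
    if "Y \<in> carrier_mat d\<^sub>1 d\<^sub>1" for Y
    using le that unfolding CP_le_def CP_map_def by (auto intro: lin_mapD)
  have dichotomy: "B t * P = 0\<^sub>m d\<^sub>2 d\<^sub>2 \<or> (\<forall>Y \<in> carrier_mat d\<^sub>1 d\<^sub>1. f t Y = f t (1\<^sub>m d\<^sub>1) * \<phi> Y)"
    if t: "t \<in> {1..m}" for t
  proof (cases "B t * P = 0\<^sub>m d\<^sub>2 d\<^sub>2")
    case False
    \<comment> \<open>A vector \<open>v\<close> in the range of \<open>P\<close> with \<open>\<langle>B\<^sub>t v, v\<rangle> > 0\<close> turns \<open>\<Psi> \<le> \<Phi>\<close> into domination of \<open>f\<^sub>t\<close> by \<open>\<phi>\<close>.\<close>
    have "\<exists>w \<in> carrier_vec d\<^sub>2. (B t * P) *\<^sub>v w \<noteq> 0\<^sub>m d\<^sub>2 d\<^sub>2 *\<^sub>v w"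
      using False Bc[OF t] Pc mat_eq_if_mult_vec_eq[of "B t * P" d\<^sub>2 d\<^sub>2 "0\<^sub>m d\<^sub>2 d\<^sub>2"]
      by (auto simp: mult_carrier_mat[of _ d\<^sub>2 d\<^sub>2])
    then obtain w where w: "w \<in> carrier_vec d\<^sub>2" "(B t * P) *\<^sub>v w \<noteq> 0\<^sub>v d\<^sub>2" by auto
    define v where "v = P *\<^sub>v w"
    have v: "v \<in> carrier_vec d\<^sub>2" using Pc w by (simp add: v_def)
    have Bv: "B t *\<^sub>v v \<noteq> 0\<^sub>v d\<^sub>2"
      using w Bc[OF t] Pc assoc_mult_mat_vec[of "B t" d\<^sub>2 d\<^sub>2 P d\<^sub>2 w] by (simp add: v_def)
    have Bs_nonneg: "0 \<le> (B s *\<^sub>v v) \<bullet>c v" if "s \<in> {1..m}" for s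
      using fB[OF that] v by (auto intro: psd_form_nonneg)
    have "(B t *\<^sub>v v) \<bullet>c v \<noteq> 0"
      using psd_form_eq_0[of d\<^sub>2 "B t" v] fB[OF t] v Bv by auto
    then obtain b where b: "(B t *\<^sub>v v) \<bullet>c v = complex_of_real b" "b > 0"
      using complex_pos_real[OF Bs_nonneg[OF t]] by blast
    have "v \<noteq> 0\<^sub>v d\<^sub>2" using Bv Bc[OF t] by auto
    then have "v \<bullet>c v \<noteq> 0" using v by simp
    then obtain a where a: "v \<bullet>c v = complex_of_real a" "a > 0"
      using complex_pos_real[OF conjugate_square_ge_0_vec] by blast
    have "complex_of_real (b / a) * f t Y \<le> \<phi> Y" if Y: "psd d\<^sub>1 Y" for Y
    proof -
      have Yc: "Y \<in> carrier_mat d\<^sub>1 d\<^sub>1" using Y by (rule psd_carrier)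
      have f_nonneg: "0 \<le> f s Y" if "s \<in> {1..m}" for s
        using fB[OF that] Y by (auto intro: CP_functional_nonneg)
      have "f t Y * ((B t *\<^sub>v v) \<bullet>c v) \<le> (\<Sum>s\<in>{1..m}. f s Y * ((B s *\<^sub>v v) \<bullet>c v))"
        using t f_nonneg Bs_nonneg
        by (intro member_le_sum[where f = "\<lambda>s. f s Y * ((B s *\<^sub>v v) \<bullet>c v)"]) auto
      also have "\<dots> = (\<Sum>s\<in>{1..m}. ((f s Y \<cdot>\<^sub>m B s) *\<^sub>v v) \<bullet>c v)"
        using Bc v by (intro sum.cong)
          (auto simp: smult_mult_mat_vec[of _ d\<^sub>2] smult_scalar_prod_distrib[of _ d\<^sub>2]
            mult_mat_vec_carrier[of _ d\<^sub>2 d\<^sub>2])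
      also have "\<dots> = (\<Psi> Y *\<^sub>v v) \<bullet>c v"
        unfolding \<Psi>[OF Yc] using Bc v by (subst cscalar_prod_mat_sum) auto
      also have "\<dots> \<le> (\<Phi> Y *\<^sub>v v) \<bullet>c v"
      proof -
        have "psd d\<^sub>2 (\<Phi> Y - \<Psi> Y)"
          using le Y CP_map_psd[of d\<^sub>1 d\<^sub>2 "\<lambda>X. \<Phi> X - \<Psi> X" Y] by (simp add: CP_le_def)
        from psd_form_nonneg[OF this v] show ?thesis
          using \<Phi>c[OF Yc] \<Psi>c[OF Yc] v
          by (simp add: minus_mult_distrib_mat_vec[of _ d\<^sub>2 d\<^sub>2] minus_scalar_prod_distrib[of _ d\<^sub>2]
              mult_mat_vec_carrier[of _ d\<^sub>2 d\<^sub>2])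
      qed
      also have "\<Phi> Y *\<^sub>v v = \<phi> Y \<cdot>\<^sub>v v"
        using assoc_mult_mat_vec[of "\<Phi> Y" d\<^sub>2 d\<^sub>2 P d\<^sub>2 w] \<Phi>c[OF Yc] Pc w(1) \<Phi>P[OF Yc]
        by (simp add: v_def smult_mult_mat_vec)
      also have "(\<phi> Y \<cdot>\<^sub>v v) \<bullet>c v = \<phi> Y * complex_of_real a"
        using v by (simp add: a(1)[symmetric])
      finally have "f t Y * complex_of_real b \<le> \<phi> Y * complex_of_real a" by (simp add: b(1))
      then show ?thesis
        using a(2) by (simp add: less_eq_complex_def field_simps)
    qed
    moreover have "CP_map d\<^sub>1 1 (to_M1 (f t))" "b / a > 0" using fB[OF t] a(2) b(2) by auto
    ultimately show ?thesis using pure_state_dominated[OF pure] by blast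
  qed auto
  \<comment> \<open>Since \<open>B\<^sub>t\<close> and \<open>P\<close> are Hermitian, the same dichotomy applies to multiplication from the left.\<close>
  have PB: "P * B t = 0\<^sub>m d\<^sub>2 d\<^sub>2" if t: "t \<in> {1..m}" and 0: "B t * P = 0\<^sub>m d\<^sub>2 d\<^sub>2" for t
  proof -
    have "P * B t = mat_adjoint (B t * P)"
      using mat_adjoint_mult[OF Bc[OF t] Pc] psd_adjoint[of d\<^sub>2 "B t"] fB[OF t] Padj by simp
    also have "\<dots> = 0\<^sub>m d\<^sub>2 d\<^sub>2" unfolding 0 by (intro eq_matI) (auto simp: mat_adjoint_index)
    finally show ?thesis .
  qed
  have one: "1\<^sub>m d\<^sub>1 \<in> carrier_mat d\<^sub>1 d\<^sub>1" by simp
  have zero: "c \<cdot>\<^sub>m 0\<^sub>m d\<^sub>2 d\<^sub>2 = (0\<^sub>m d\<^sub>2 d\<^sub>2 :: complex mat)" for c by (intro eq_matI) auto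
  have smult2: "c \<cdot>\<^sub>m (e \<cdot>\<^sub>m M) = (c * e) \<cdot>\<^sub>m M" for c e :: complex and M
    by (intro eq_matI) auto
  have "\<Psi> X * P = mat_sum d\<^sub>2 (\<lambda>t. f t X \<cdot>\<^sub>m (B t * P)) {1..m}"
    unfolding \<Psi>[OF X] using Bc Pc by (intro mat_sum_smult_mult) auto
  also have "\<dots> = mat_sum d\<^sub>2 (\<lambda>t. \<phi> X \<cdot>\<^sub>m (f t (1\<^sub>m d\<^sub>1) \<cdot>\<^sub>m (B t * P))) {1..m}"
  proof (rule mat_sum_cong)
    fix t assume t: "t \<in> {1..m}"
    show "f t X \<cdot>\<^sub>m (B t * P) = \<phi> X \<cdot>\<^sub>m (f t (1\<^sub>m d\<^sub>1) \<cdot>\<^sub>m (B t * P))"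
      using dichotomy[OF t] X by (metis zero smult2 mult.commute)
    show "\<phi> X \<cdot>\<^sub>m (f t (1\<^sub>m d\<^sub>1) \<cdot>\<^sub>m (B t * P)) \<in> carrier_mat d\<^sub>2 d\<^sub>2"
      using Bc[OF t] Pc by (simp add: mult_carrier_mat[of _ d\<^sub>2 d\<^sub>2])
  qed
  also have "\<dots> = \<phi> X \<cdot>\<^sub>m mat_sum d\<^sub>2 (\<lambda>t. f t (1\<^sub>m d\<^sub>1) \<cdot>\<^sub>m (B t * P)) {1..m}"
    using Bc Pc by (subst smult_mat_sum) (auto simp: mult_carrier_mat[of _ d\<^sub>2 d\<^sub>2])
  also have "mat_sum d\<^sub>2 (\<lambda>t. f t (1\<^sub>m d\<^sub>1) \<cdot>\<^sub>m (B t * P)) {1..m} = \<Psi> (1\<^sub>m d\<^sub>1) * P"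
    unfolding \<Psi>[OF one] using Bc Pc by (intro mat_sum_smult_mult[symmetric]) auto
  finally show "\<Psi> X * P = \<phi> X \<cdot>\<^sub>m (\<Psi> (1\<^sub>m d\<^sub>1) * P)" .
  have "P * \<Psi> X = mat_sum d\<^sub>2 (\<lambda>t. f t X \<cdot>\<^sub>m (P * B t)) {1..m}"
    unfolding \<Psi>[OF X] using Bc Pc by (intro mat_sum_smult_mult) auto
  also have "\<dots> = mat_sum d\<^sub>2 (\<lambda>t. \<phi> X \<cdot>\<^sub>m (f t (1\<^sub>m d\<^sub>1) \<cdot>\<^sub>m (P * B t))) {1..m}"
  proof (rule mat_sum_cong)
    fix t assume t: "t \<in> {1..m}"
    show "f t X \<cdot>\<^sub>m (P * B t) = \<phi> X \<cdot>\<^sub>m (f t (1\<^sub>m d\<^sub>1) \<cdot>\<^sub>m (P * B t))"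
      using dichotomy[OF t] PB[OF t] X by (metis zero smult2 mult.commute)
    show "\<phi> X \<cdot>\<^sub>m (f t (1\<^sub>m d\<^sub>1) \<cdot>\<^sub>m (P * B t)) \<in> carrier_mat d\<^sub>2 d\<^sub>2"
      using Bc[OF t] Pc by (simp add: mult_carrier_mat[of _ d\<^sub>2 d\<^sub>2])
  qed
  also have "\<dots> = \<phi> X \<cdot>\<^sub>m mat_sum d\<^sub>2 (\<lambda>t. f t (1\<^sub>m d\<^sub>1) \<cdot>\<^sub>m (P * B t)) {1..m}"
    using Bc Pc by (subst smult_mat_sum) (auto simp: mult_carrier_mat[of _ d\<^sub>2 d\<^sub>2])
  also have "mat_sum d\<^sub>2 (\<lambda>t. f t (1\<^sub>m d\<^sub>1) \<cdot>\<^sub>m (P * B t)) {1..m} = P * \<Psi> (1\<^sub>m d\<^sub>1)"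
    unfolding \<Psi>[OF one] using Bc Pc by (intro mat_sum_smult_mult[symmetric]) auto
  finally show "P * \<Psi> X = \<phi> X \<cdot>\<^sub>m (P * \<Psi> (1\<^sub>m d\<^sub>1))" .
qed

section \<open>The order below a sum of orthogonal pure states\<close>

theorem theorem4p2:
  fixes d\<^sub>1 d\<^sub>2 n :: nat
    and \<Phi> \<Psi> :: "complex mat \<Rightarrow> complex mat"
    and \<phi> :: "nat \<Rightarrow> complex mat \<Rightarrow> complex"
    and P :: "nat \<Rightarrow> complex mat"
  assumes "d\<^sub>1 \<ge> 1" and "d\<^sub>2 \<ge> 1"
    and "\<Phi> \<in> UEB d\<^sub>1 d\<^sub>2"
    and "\<forall>X \<in> carrier_mat d\<^sub>1 d\<^sub>1. \<Phi> X = mat_sum d\<^sub>2 (\<lambda>i. \<phi> i X \<cdot>\<^sub>m P i) {1..n}"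
    and "\<forall>i \<in> {1..n}. pure_state d\<^sub>1 (\<phi> i)"
    and "\<forall>i \<in> {1..n}. \<forall>j \<in> {1..n}. i \<noteq> j \<longrightarrow> (\<exists>X \<in> carrier_mat d\<^sub>1 d\<^sub>1. \<phi> i X \<noteq> \<phi> j X)"
    and "\<forall>i \<in> {1..n}. orth_projection d\<^sub>2 (P i)"
    and "\<forall>i \<in> {1..n}. \<forall>j \<in> {1..n}. i \<noteq> j \<longrightarrow> P i * P j = 0\<^sub>m d\<^sub>2 d\<^sub>2"
    and "mat_sum d\<^sub>2 P {1..n} = 1\<^sub>m d\<^sub>2"
    and "EB_map d\<^sub>1 d\<^sub>2 \<Psi>"
  defines "cond1 \<equiv> EB_le d\<^sub>1 d\<^sub>2 \<Psi> \<Phi>"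
    and "cond2 \<equiv> CP_le d\<^sub>1 d\<^sub>2 \<Psi> \<Phi>"
    and "cond3 \<equiv> \<exists>R :: nat \<Rightarrow> complex mat.
           (\<forall>i \<in> {1..n}. positive_contraction d\<^sub>2 (R i)) \<and>
           (\<forall>i \<in> {1..n}. \<forall>j \<in> {1..n}.
              P i * R j = (if i = j then R j else 0\<^sub>m d\<^sub>2 d\<^sub>2) \<and>
              R j * P i = (if i = j then R j else 0\<^sub>m d\<^sub>2 d\<^sub>2)) \<and>
           (\<forall>X \<in> carrier_mat d\<^sub>1 d\<^sub>1. \<Psi> X = mat_sum d\<^sub>2 (\<lambda>i. \<phi> i X \<cdot>\<^sub>m R i) {1..n})"
    and "cond4 \<equiv> \<exists>R.
           positive_contraction d\<^sub>2 R \<and> R \<in> commutant d\<^sub>2 (map_range d\<^sub>1 \<Phi>) \<and>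
           (\<forall>X \<in> carrier_mat d\<^sub>1 d\<^sub>1.
              \<Psi> X = Ad (psd_sqrt d\<^sub>2 R) (\<Phi> X) \<and> \<Psi> X = \<Phi> X * R)"
  shows "(cond1 \<longleftrightarrow> cond2) \<and> (cond2 \<longleftrightarrow> cond3) \<and> (cond3 \<longleftrightarrow> cond4)"
proof -
  let ?I = "{1..n}"
  note sumP = assms(9)
  have \<Phi>EB: "EB_map d\<^sub>1 d\<^sub>2 \<Phi>" and \<Phi>1: "\<Phi> (1\<^sub>m d\<^sub>1) = 1\<^sub>m d\<^sub>2"
    using assms(3) by (auto simp: UEB_def)
  have \<Phi>CP: "CP_map d\<^sub>1 d\<^sub>2 \<Phi>" and \<Psi>CP: "CP_map d\<^sub>1 d\<^sub>2 \<Psi>"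
    using \<Phi>EB assms(10) by (auto simp: EB_map_def)
  have \<Phi>lin: "lin_map d\<^sub>1 d\<^sub>2 \<Phi>" and \<Psi>lin: "lin_map d\<^sub>1 d\<^sub>2 \<Psi>"
    using \<Phi>CP \<Psi>CP by (auto simp: CP_map_def)
  note \<Phi>c = lin_mapD(1)[OF \<Phi>lin] and \<Psi>c = lin_mapD(1)[OF \<Psi>lin]
  have one: "1\<^sub>m d\<^sub>1 \<in> carrier_mat d\<^sub>1 d\<^sub>1" by simp
  have \<Phi>: "\<Phi> X = mat_sum d\<^sub>2 (\<lambda>i. \<phi> i X \<cdot>\<^sub>m P i) ?I" if "X \<in> carrier_mat d\<^sub>1 d\<^sub>1" for X
    using assms(4) that by blast
  have proj: "orth_projection d\<^sub>2 (P i)" and Pc: "P i \<in> carrier_mat d\<^sub>2 d\<^sub>2" and PP: "P i * P i = P i"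
    if "i \<in> ?I" for i
    using assms(7) that by (auto simp: orth_projection_def)
  have Porth: "P i * P j = 0\<^sub>m d\<^sub>2 d\<^sub>2" if "i \<in> ?I" "j \<in> ?I" "i \<noteq> j" for i j
    using assms(8) that by blast
  have pure: "pure_state d\<^sub>1 (\<phi> i)" and \<phi>CP: "CP_map d\<^sub>1 1 (to_M1 (\<phi> i))" if "i \<in> ?I" for i
    using assms(5) that by (auto simp: pure_state_def state_def)
  have smult0: "c \<cdot>\<^sub>m 0\<^sub>m d\<^sub>2 d\<^sub>2 = (0\<^sub>m d\<^sub>2 d\<^sub>2 :: complex mat)" for c by (intro eq_matI) auto
  note mc = mult_carrier_mat[of _ d\<^sub>2 d\<^sub>2 _ d\<^sub>2]
  have sum_right: "M = mat_sum d\<^sub>2 (\<lambda>i. M * P i) ?I"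
    and sum_left: "M = mat_sum d\<^sub>2 (\<lambda>i. P i * M) ?I" if "M \<in> carrier_mat d\<^sub>2 d\<^sub>2" for M
    using mat_sum_mult_left[of ?I P d\<^sub>2 M, unfolded sumP]
      mat_sum_mult_right[of ?I P d\<^sub>2 M, unfolded sumP] Pc that by auto
  have \<Phi>P: "\<Phi> X * P j = \<phi> j X \<cdot>\<^sub>m P j" if j: "j \<in> ?I" and X: "X \<in> carrier_mat d\<^sub>1 d\<^sub>1" for j X
  proof -
    have "\<Phi> X * P j = mat_sum d\<^sub>2 (\<lambda>i. \<phi> i X \<cdot>\<^sub>m (P i * P j)) ?I"
      unfolding \<Phi>[OF X] using Pc j by (intro mat_sum_smult_mult) auto
    also have "\<dots> = mat_sum d\<^sub>2 (\<lambda>i. if i = j then \<phi> i X \<cdot>\<^sub>m P i else 0\<^sub>m d\<^sub>2 d\<^sub>2) ?I"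
    proof (rule mat_sum_cong)
      fix i assume i: "i \<in> ?I"
      show "\<phi> i X \<cdot>\<^sub>m (P i * P j) = (if i = j then \<phi> i X \<cdot>\<^sub>m P i else 0\<^sub>m d\<^sub>2 d\<^sub>2)"
        using i j by (simp add: PP Porth smult0)
      show "(if i = j then \<phi> i X \<cdot>\<^sub>m P i else 0\<^sub>m d\<^sub>2 d\<^sub>2) \<in> carrier_mat d\<^sub>2 d\<^sub>2"
        using Pc[OF j] by simp
    qed
    also have "\<dots> = \<phi> j X \<cdot>\<^sub>m P j"
      using j Pc[OF j] by (intro mat_sum_delta) auto
    finally show ?thesis .
  qed

  have "cond2" if "cond1"
    using that by (auto simp: cond1_def cond2_def EB_le_def CP_le_def EB_map_def)

  moreover have "cond3" if "cond2"
  proof -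
    have le: "CP_le d\<^sub>1 d\<^sub>2 \<Psi> \<Phi>" using that by (simp add: cond2_def)
    define R where "R = \<Psi> (1\<^sub>m d\<^sub>1)"
    have Rc: "R \<in> carrier_mat d\<^sub>2 d\<^sub>2" unfolding R_def by (rule \<Psi>c[OF one])
    have "psd d\<^sub>2 (\<Phi> (1\<^sub>m d\<^sub>1) - \<Psi> (1\<^sub>m d\<^sub>1))"
      using le CP_map_psd[of d\<^sub>1 d\<^sub>2 "\<lambda>X. \<Phi> X - \<Psi> X" "1\<^sub>m d\<^sub>1"] by (simp add: CP_le_def)
    then have R: "positive_contraction d\<^sub>2 R"
      using CP_map_psd[OF \<Psi>CP, of "1\<^sub>m d\<^sub>1"] by (simp add: positive_contraction_def R_def \<Phi>1)
    have \<Psi>P: "\<Psi> X * P i = \<phi> i X \<cdot>\<^sub>m (R * P i)" and P\<Psi>: "P i * \<Psi> X = \<phi> i X \<cdot>\<^sub>m (P i * R)"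
      if "i \<in> ?I" "X \<in> carrier_mat d\<^sub>1 d\<^sub>1" for i X
      using EB_below_pure_corner[OF assms(1,10) le pure proj \<Phi>P that(2), of i] that
      by (auto simp: R_def)
    \<comment> \<open>Evaluating \<open>P\<^sub>i \<Psi>(X) P\<^sub>j\<close> from the left and from the right at an \<open>X\<close> that separates the two states.\<close>
    have off_diag: "P i * R * P j = 0\<^sub>m d\<^sub>2 d\<^sub>2" if ij: "i \<in> ?I" "j \<in> ?I" "i \<noteq> j" for i j
    proof -
      obtain X where X: "X \<in> carrier_mat d\<^sub>1 d\<^sub>1" "\<phi> i X \<noteq> \<phi> j X" using assms(6) ij by blast
      let ?M = "P i * R * P j"
      have M: "?M \<in> carrier_mat d\<^sub>2 d\<^sub>2" using Pc ij Rc by (simp add: mc)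
      have "\<phi> i X \<cdot>\<^sub>m ?M = (P i * \<Psi> X) * P j"
        using P\<Psi>[OF ij(1) X(1)] Pc ij Rc by (simp add: mult_smult_assoc_mat[of _ d\<^sub>2 d\<^sub>2 _ d\<^sub>2] mult_smult_distrib[of _ d\<^sub>2 d\<^sub>2 _ d\<^sub>2] mc)
      also have "\<dots> = P i * (\<Psi> X * P j)"
        using Pc ij \<Psi>c[OF X(1)] by (intro assoc_mult_mat) auto
      also have "\<dots> = \<phi> j X \<cdot>\<^sub>m ?M"
        using \<Psi>P[OF ij(2) X(1)] Pc[OF ij(1)] Pc[OF ij(2)] Rc
        by (simp add: mult_smult_assoc_mat[of _ d\<^sub>2 d\<^sub>2 _ d\<^sub>2] mult_smult_distrib[of _ d\<^sub>2 d\<^sub>2 _ d\<^sub>2] mc assoc_mult_mat[of _ d\<^sub>2 d\<^sub>2 _ d\<^sub>2 _ d\<^sub>2])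
      finally have eq: "\<phi> i X \<cdot>\<^sub>m ?M = \<phi> j X \<cdot>\<^sub>m ?M" .
      show ?thesis
      proof (rule eq_matI)
        fix a b assume "a < dim_row (0\<^sub>m d\<^sub>2 d\<^sub>2 :: complex mat)" "b < dim_col (0\<^sub>m d\<^sub>2 d\<^sub>2 :: complex mat)"
        then have ab: "a < d\<^sub>2" "b < d\<^sub>2" by auto
        have "(\<phi> i X \<cdot>\<^sub>m ?M) $$ (a, b) = (\<phi> j X \<cdot>\<^sub>m ?M) $$ (a, b)" by (simp only: eq)
        then have "\<phi> i X * ?M $$ (a, b) = \<phi> j X * ?M $$ (a, b)"
          using M ab by (simp only: index_smult_mat carrier_matD)
        then show "?M $$ (a, b) = 0\<^sub>m d\<^sub>2 d\<^sub>2 $$ (a, b)" using X(2) ab by simp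
      qed (use carrier_matD[OF M] in simp_all)
    qed
    have RP: "R * P j = P j * R * P j" and PR: "P j * R = P j * R * P j" if j: "j \<in> ?I" for j
    proof -
      have PRP: "P j * R * P j \<in> carrier_mat d\<^sub>2 d\<^sub>2" "R * P j \<in> carrier_mat d\<^sub>2 d\<^sub>2"
        "P j * R \<in> carrier_mat d\<^sub>2 d\<^sub>2" using Pc[OF j] Rc by (simp_all add: mc)
      have "R * P j = mat_sum d\<^sub>2 (\<lambda>i. P i * (R * P j)) ?I"
        by (rule sum_left[OF PRP(2)])
      also have "\<dots> = mat_sum d\<^sub>2 (\<lambda>i. if i = j then P i * R * P j else 0\<^sub>m d\<^sub>2 d\<^sub>2) ?I"
      proof (rule mat_sum_cong)
        fix i assume i: "i \<in> ?I"
        have "P i * (R * P j) = P i * R * P j"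
          using Pc[OF i] Pc[OF j] Rc by (intro assoc_mult_mat[symmetric]) auto
        then show "P i * (R * P j) = (if i = j then P i * R * P j else 0\<^sub>m d\<^sub>2 d\<^sub>2)"
          using off_diag[OF i j] by simp
        show "(if i = j then P i * R * P j else 0\<^sub>m d\<^sub>2 d\<^sub>2) \<in> carrier_mat d\<^sub>2 d\<^sub>2"
          using PRP by simp
      qed
      also have "\<dots> = P j * R * P j" using j PRP by (intro mat_sum_delta) auto
      finally show "R * P j = P j * R * P j" .
      have "P j * R = mat_sum d\<^sub>2 (\<lambda>i. P j * R * P i) ?I"
        by (rule sum_right[OF PRP(3)])
      also have "\<dots> = mat_sum d\<^sub>2 (\<lambda>i. if i = j then P j * R * P i else 0\<^sub>m d\<^sub>2 d\<^sub>2) ?I"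
      proof (rule mat_sum_cong)
        fix i assume i: "i \<in> ?I"
        show "P j * R * P i = (if i = j then P j * R * P i else 0\<^sub>m d\<^sub>2 d\<^sub>2)"
          using off_diag[OF j i] by simp
        show "(if i = j then P j * R * P i else 0\<^sub>m d\<^sub>2 d\<^sub>2) \<in> carrier_mat d\<^sub>2 d\<^sub>2"
          using PRP by simp
      qed
      also have "\<dots> = P j * R * P j" using j PRP by (intro mat_sum_delta) auto
      finally show "P j * R = P j * R * P j" .
    qed
    have comm: "R * P i = P i * R" if "i \<in> ?I" for i
      using RP[OF that] PR[OF that] by (rule trans[OF _ sym])
    have assoc: "A * B * C = A * (B * C)"
      if "A \<in> carrier_mat d\<^sub>2 d\<^sub>2" "B \<in> carrier_mat d\<^sub>2 d\<^sub>2" "C \<in> carrier_mat d\<^sub>2 d\<^sub>2" for A B C :: "complex mat"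
      using that by (rule assoc_mult_mat)
    show cond3
      unfolding cond3_def
    proof (intro exI[of _ "\<lambda>i. R * P i"] conjI ballI)
      fix i assume i: "i \<in> ?I"
      show "positive_contraction d\<^sub>2 (R * P i)"
        using R proj[OF i] comm[OF i] by (rule positive_contraction_compression)
    next
      fix i j assume i: "i \<in> ?I" and j: "j \<in> ?I"
      have "P i * (R * P j) = R * (P i * P j)"
        using comm[OF i] Pc[OF i] Pc[OF j] Rc assoc by metis
      then show "P i * (R * P j) = (if i = j then R * P j else 0\<^sub>m d\<^sub>2 d\<^sub>2)"
        using PP[OF j] Porth[OF i j] Rc by auto
      have "R * P j * P i = R * (P j * P i)"
        using Pc[OF i] Pc[OF j] Rc assoc by metis
      then show "R * P j * P i = (if i = j then R * P j else 0\<^sub>m d\<^sub>2 d\<^sub>2)"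
        using PP[OF j] Porth[OF j i] Rc by auto
    next
      fix X :: "complex mat" assume X: "X \<in> carrier_mat d\<^sub>1 d\<^sub>1"
      have "\<Psi> X = mat_sum d\<^sub>2 (\<lambda>i. \<Psi> X * P i) ?I"
        by (rule sum_right[OF \<Psi>c[OF X]])
      also have "\<dots> = mat_sum d\<^sub>2 (\<lambda>i. \<phi> i X \<cdot>\<^sub>m (R * P i)) ?I"
        using \<Psi>P X Pc Rc by (intro mat_sum_cong) (auto simp: mc)
      finally show "\<Psi> X = mat_sum d\<^sub>2 (\<lambda>i. \<phi> i X \<cdot>\<^sub>m (R * P i)) ?I" .
    qed
  qed

  moreover have "cond1" and "cond4" if c3: "cond3"
  proof -
    obtain R where R: "\<And>i. i \<in> ?I \<Longrightarrow> positive_contraction d\<^sub>2 (R i)"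
      and PR: "\<And>i j. i \<in> ?I \<Longrightarrow> j \<in> ?I \<Longrightarrow> P i * R j = (if i = j then R j else 0\<^sub>m d\<^sub>2 d\<^sub>2)"
      and RP: "\<And>i j. i \<in> ?I \<Longrightarrow> j \<in> ?I \<Longrightarrow> R j * P i = (if i = j then R j else 0\<^sub>m d\<^sub>2 d\<^sub>2)"
      and \<Psi>: "\<And>X. X \<in> carrier_mat d\<^sub>1 d\<^sub>1 \<Longrightarrow> \<Psi> X = mat_sum d\<^sub>2 (\<lambda>i. \<phi> i X \<cdot>\<^sub>m R i) ?I"
      using c3[unfolded cond3_def] by blast
    have Rpsd: "psd d\<^sub>2 (R i)" if "i \<in> ?I" for i
      using R[OF that] by (simp add: positive_contraction_def)
    have Rc: "R i \<in> carrier_mat d\<^sub>2 d\<^sub>2" if "i \<in> ?I" for i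
      using Rpsd[OF that] by (rule psd_carrier)
    have PRpsd: "psd d\<^sub>2 (P i - R i)" if "i \<in> ?I" for i
      using R[OF that] proj[OF that] PR[OF that that] RP[OF that that]
      by (intro psd_corner_complement) auto
    have "EB_map d\<^sub>1 d\<^sub>2 (\<lambda>X. \<Phi> X - \<Psi> X)"
    proof (rule EB_map_measure_prepare[OF lin_map_minus[OF \<Phi>lin \<Psi>lin] \<phi>CP PRpsd])
      fix X :: "complex mat" assume X: "X \<in> carrier_mat d\<^sub>1 d\<^sub>1"
      have "\<Phi> X - \<Psi> X = mat_sum d\<^sub>2 (\<lambda>i. \<phi> i X \<cdot>\<^sub>m P i - \<phi> i X \<cdot>\<^sub>m R i) ?I"
        unfolding \<Phi>[OF X] \<Psi>[OF X] using Pc Rc by (intro mat_sum_minus) auto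
      also have "\<dots> = mat_sum d\<^sub>2 (\<lambda>i. \<phi> i X \<cdot>\<^sub>m (P i - R i)) ?I"
      proof (rule mat_sum_cong)
        fix i assume i: "i \<in> ?I"
        show "\<phi> i X \<cdot>\<^sub>m P i - \<phi> i X \<cdot>\<^sub>m R i = \<phi> i X \<cdot>\<^sub>m (P i - R i)"
          using Pc[OF i] Rc[OF i] by (intro eq_matI) (auto simp: right_diff_distrib)
        show "\<phi> i X \<cdot>\<^sub>m (P i - R i) \<in> carrier_mat d\<^sub>2 d\<^sub>2"
          using Rc[OF i] by (simp add: minus_carrier_mat)
      qed
      finally show "\<Phi> X - \<Psi> X = mat_sum d\<^sub>2 (\<lambda>i. \<phi> i X \<cdot>\<^sub>m (P i - R i)) ?I" .
    qed auto
    then show cond1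
      using \<Phi>EB assms(10) by (simp add: cond1_def EB_le_def)

    define S where "S = mat_sum d\<^sub>2 R ?I"
    have Sc: "S \<in> carrier_mat d\<^sub>2 d\<^sub>2" unfolding S_def using Rc by (rule mat_sum_carrier)
    have PS: "P j * S = R j" and SP: "S * P j = R j" if j: "j \<in> ?I" for j
    proof -
      have "P j * S = mat_sum d\<^sub>2 (\<lambda>i. P j * R i) ?I"
        unfolding S_def using Rc Pc[OF j] by (intro mat_sum_mult_left) auto
      also have "\<dots> = mat_sum d\<^sub>2 (\<lambda>i. if i = j then R i else 0\<^sub>m d\<^sub>2 d\<^sub>2) ?I"
        using PR[OF j] Rc by (intro mat_sum_cong) auto
      also have "\<dots> = R j" using j Rc by (intro mat_sum_delta) auto
      finally show "P j * S = R j" .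
      have "S * P j = mat_sum d\<^sub>2 (\<lambda>i. R i * P j) ?I"
        unfolding S_def using Rc Pc[OF j] by (intro mat_sum_mult_right) auto
      also have "\<dots> = mat_sum d\<^sub>2 (\<lambda>i. if i = j then R i else 0\<^sub>m d\<^sub>2 d\<^sub>2) ?I"
        using RP[OF j] Rc by (intro mat_sum_cong) auto
      also have "\<dots> = R j" using j Rc by (intro mat_sum_delta) auto
      finally show "S * P j = R j" .
    qed
    have Spsd: "psd d\<^sub>2 S" unfolding S_def using Rpsd by (intro psd_mat_sum) auto
    have "1\<^sub>m d\<^sub>2 - S = mat_sum d\<^sub>2 (\<lambda>i. P i - R i) ?I"
      unfolding S_def sumP[symmetric] using Pc Rc by (intro mat_sum_minus) auto
    also have "psd d\<^sub>2 \<dots>" using PRpsd by (intro psd_mat_sum) auto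
    finally have S: "positive_contraction d\<^sub>2 S" using Spsd by (simp add: positive_contraction_def)
    have \<Phi>S: "\<Phi> X * S = \<Psi> X" and S\<Phi>: "S * \<Phi> X = \<Psi> X" if X: "X \<in> carrier_mat d\<^sub>1 d\<^sub>1" for X
    proof -
      have "\<Phi> X * S = mat_sum d\<^sub>2 (\<lambda>i. \<phi> i X \<cdot>\<^sub>m (P i * S)) ?I"
        unfolding \<Phi>[OF X] using Pc Sc by (intro mat_sum_smult_mult) auto
      also have "\<dots> = \<Psi> X"
        unfolding \<Psi>[OF X] using PS Rc by (intro mat_sum_cong) auto
      finally show "\<Phi> X * S = \<Psi> X" .
      have "S * \<Phi> X = mat_sum d\<^sub>2 (\<lambda>i. \<phi> i X \<cdot>\<^sub>m (S * P i)) ?I"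
        unfolding \<Phi>[OF X] using Pc Sc by (intro mat_sum_smult_mult) auto
      also have "\<dots> = \<Psi> X"
        unfolding \<Psi>[OF X] using SP Rc by (intro mat_sum_cong) auto
      finally show "S * \<Phi> X = \<Psi> X" .
    qed
    show cond4
      unfolding cond4_def
    proof (intro exI[of _ S] conjI ballI S)
      show "S \<in> commutant d\<^sub>2 (map_range d\<^sub>1 \<Phi>)"
        using Sc \<Phi>S S\<Phi> by (auto simp: commutant_def map_range_def)
      fix X :: "complex mat" assume X: "X \<in> carrier_mat d\<^sub>1 d\<^sub>1"
      show "\<Psi> X = \<Phi> X * S" using \<Phi>S[OF X] by simp
      let ?T = "psd_sqrt d\<^sub>2 S"
      have Tc: "?T \<in> carrier_mat d\<^sub>2 d\<^sub>2" using psd_sqrt(1)[OF Spsd] by (rule psd_carrier)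
      have "?T * \<Phi> X = \<Phi> X * ?T"
        using psd_sqrt(3)[OF Spsd \<Phi>c[OF X]] \<Phi>S[OF X] S\<Phi>[OF X] by simp
      then have "Ad ?T (\<Phi> X) = \<Phi> X * ?T * ?T"
        by (simp add: Ad_def psd_adjoint[OF psd_sqrt(1)[OF Spsd]])
      also have "\<dots> = \<Phi> X * S"
        using assoc_mult_mat[OF \<Phi>c[OF X] Tc Tc] psd_sqrt(2)[OF Spsd] by simp
      finally show "\<Psi> X = Ad ?T (\<Phi> X)" using \<Phi>S[OF X] by simp
    qed
  qed

  moreover have "cond2" if c4: "cond4"
  proof -
    obtain R where R: "positive_contraction d\<^sub>2 R" and comm: "R \<in> commutant d\<^sub>2 (map_range d\<^sub>1 \<Phi>)"
      and \<Psi>: "\<And>X. X \<in> carrier_mat d\<^sub>1 d\<^sub>1 \<Longrightarrow> \<Psi> X = \<Phi> X * R"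
      using c4[unfolded cond4_def] by blast
    define T where "T = 1\<^sub>m d\<^sub>2 - R"
    have Tpsd: "psd d\<^sub>2 T" using R by (simp add: T_def positive_contraction_def)
    have Rc: "R \<in> carrier_mat d\<^sub>2 d\<^sub>2" using R by (auto simp: positive_contraction_def dest: psd_carrier)
    let ?V = "psd_sqrt d\<^sub>2 T"
    have Vc: "?V \<in> carrier_mat d\<^sub>2 d\<^sub>2" using psd_sqrt(1)[OF Tpsd] by (rule psd_carrier)
    have "CP_map d\<^sub>1 d\<^sub>2 (\<lambda>X. \<Phi> X - \<Psi> X)"
    proof (rule CP_map_sandwich[OF \<Phi>CP Vc lin_map_minus[OF \<Phi>lin \<Psi>lin]])
      fix X :: "complex mat" assume X: "X \<in> carrier_mat d\<^sub>1 d\<^sub>1"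
      note \<Phi>Xc = \<Phi>c[OF X]
      have RX: "R * \<Phi> X = \<Phi> X * R" using comm X by (auto simp: commutant_def map_range_def)
      have \<Phi>T: "\<Phi> X * T = \<Phi> X - \<Psi> X"
        unfolding T_def \<Psi>[OF X] using \<Phi>Xc Rc by (simp add: mult_minus_distrib_mat[of _ d\<^sub>2 d\<^sub>2 _ d\<^sub>2])
      have "T * \<Phi> X = \<Phi> X - \<Psi> X"
        unfolding T_def \<Psi>[OF X] RX[symmetric] using \<Phi>Xc Rc
        by (simp add: minus_mult_distrib_mat[of _ d\<^sub>2 d\<^sub>2 _ _ d\<^sub>2])
      then have "?V * \<Phi> X = \<Phi> X * ?V"
        using psd_sqrt(3)[OF Tpsd \<Phi>Xc] \<Phi>T by simp
      then have "mat_adjoint ?V * \<Phi> X * ?V = \<Phi> X * ?V * ?V"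
        by (simp add: psd_adjoint[OF psd_sqrt(1)[OF Tpsd]])
      also have "\<dots> = \<Phi> X * T"
        using assoc_mult_mat[OF \<Phi>Xc Vc Vc] psd_sqrt(2)[OF Tpsd] by simp
      finally show "\<Phi> X - \<Psi> X = mat_adjoint ?V * \<Phi> X * ?V" using \<Phi>T by simp
    qed
    then show cond2 using \<Phi>CP \<Psi>CP by (simp add: cond2_def CP_le_def)
  qed

  ultimately show ?thesis by blast
qed

end
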